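(* Every oriented graph $G$ on $n$ vertices with maximum degree at most 6 satisfies $\mathrm{fv}(G) \le \frac{4n}{7}$.
   Context: An oriented graph is a finite directed graph with no loops, no parallel arcs and no digons (no pair of opposite arcs between the same two vertices). The degree of a vertex is the sum of its in-degree and out-degree. $\mathrm{fv}(G)$ denotes the minimum number of vertices whose deletion from $G$ leaves a graph with no directed cycle. *)

theory Defs
  imports "Graph_Theory.Digraph_Component"
begin

locale oriented_graph = digraph +
  assumes no_digons: "u \<rightarrow>\<^bsub>G\<^esub> v \<Longrightarrow> \<not> v \<rightarrow>\<^bsub>G\<^esub> u"

definition vertex_degree :: "('a, 'b) pre_digraph \<Rightarrow> 'a \<Rightarrow> nat" where
  "vertex_degree G v = in_degree G v + out_degree G v"

definition feedback_vertex_set :: "('a, 'b) pre_digraph \<Rightarrow> 'a set \<Rightarrow> bool" where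
  "feedback_vertex_set G S \<longleftrightarrow>
     S \<subseteq> verts G \<and> \<not> (\<exists>p. pre_digraph.cycle (G \<restriction> (verts G - S)) p)"

text \<open>Meaningful only for finite digraphs: an infinite \<open>S\<close> would have \<open>card S = 0\<close>.\<close>

definition fv :: "('a, 'b) pre_digraph \<Rightarrow> nat" where
  "fv G = (LEAST k. \<exists>S. feedback_vertex_set G S \<and> card S = k)"

lemma feedback_vertex_set_verts: "feedback_vertex_set G (verts G)"
  by (simp add: feedback_vertex_set_def pre_digraph.cycle_def pre_digraph.awalk_def)

lemma (in fin_digraph) fv_attained:
  obtains S where "feedback_vertex_set G S" "finite S" "card S = fv G"
    "\<And>T. feedback_vertex_set G T \<Longrightarrow> card S \<le> card T"
proof -
  have "\<exists>S. feedback_vertex_set G S \<and> card S = fv G"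
    unfolding fv_def by (rule LeastI_ex) (use feedback_vertex_set_verts in blast)
  then obtain S where S: "feedback_vertex_set G S" "card S = fv G" by blast
  moreover have "finite S"
    using S(1) finite_verts unfolding feedback_vertex_set_def by (blast intro: finite_subset)
  moreover have "card S \<le> card T" if "feedback_vertex_set G T" for T
    unfolding S(2) fv_def by (rule Least_le) (use that in blast)
  ultimately show thesis using that by blast
qed

end

(*
  Write tau for the feedback number, n for the number of vertices and m for the number of arcs. The heart of the
  proof is that 7 tau <= n + m + 1 for every connected oriented graph. If the maximum degree is at most 6 then
  m <= 3 n, and m <= 3 n - 1 unless the graph is 6-regular, so only connected 6-regular graphs with 7 tau = 4 n + 1
  remain.

  In a minimal counterexample, suppose that deleting k vertices turns all further vertices of a set Y into sources
  or sinks one after another. Comparing the bound for the components of V - Y with the one for V shows that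
  V - Y has many extremal components C, those with 7 tau(C) = n(C) + m(C) + 1, and each of them sends at least four arcs to Y. Suitable
  choices of Y (and the contraction of arcs) bound the degrees by 5 from above and all in- and out-degrees by 2 from
  below, then exclude vertices of degree 5, and finally transitive triangles in the remaining 2-in-2-out case. There
  every vertex v spans a set Y of five vertices: v, its two out-neighbours and their other in-neighbours (or dually).
  Choosing Y and a component K of V - Y with K as large as possible, every vertex of another extremal component must be
  adjacent to the neighbourhood of K, and counting arcs leaves only two small cases.

  The 6-regular case uses the same extremal choice, with Y a vertex together with its in- or its out-neighbourhood,
  whichever has at most three vertices.
*)
theory Submission
  imports Defs
begin

text \<open>The directed triangle has 7 tau = 7 = n + m + 1, so the additive 1 cannot be lowered;
  the Paley tournament on seven vertices has feedback number 4 and attains 4 n / 7. The additive 1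
  is also the obstacle: after a deletion every component may contribute it, so the naive count
  breaks down when the graph falls apart into many extremal pieces. The remedy is a price for such
  pieces. Replacing everything outside a piece by just two auxiliary vertices gives a smaller
  oriented graph, and minimality then forces the piece to have many boundary arcs. If Y goes at the
  cost of k deletions and s = wt Y + btw - 7 k is nonnegative, there are at least s + 2 extremal
  components, which is absurd once btw < 4 (s + 2). Most local configurations fall to this single
  test. Where it barely fails, exactly two extremal components remain; their optimal feedback sets
  are then glued across part of Y, which saves one deletion.\<close>

text \<open>Acyclicity is expressed by a rank function that increases along arcs, so that no walks or cycles are needed.\<close>

definition acyc :: "('a \<times> 'a) set \<Rightarrow> 'a set \<Rightarrow> bool" where
  "acyc E W \<longleftrightarrow> (\<exists>f :: 'a \<Rightarrow> nat. \<forall>x\<in>W. \<forall>y\<in>W. (x, y) \<in> E \<longrightarrow> f x < f y)"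

definition tau :: "('a \<times> 'a) set \<Rightarrow> 'a set \<Rightarrow> nat" where
  "tau E W = (LEAST k. \<exists>S. S \<subseteq> W \<and> acyc E (W - S) \<and> card S = k)"

definition ind :: "('a \<times> 'a) set \<Rightarrow> 'a set \<Rightarrow> ('a \<times> 'a) set" where
  "ind E W = E \<inter> W \<times> W"

definition wt :: "('a \<times> 'a) set \<Rightarrow> 'a set \<Rightarrow> int" where
  "wt E W = int (card W) + int (card (ind E W))"

definition btw :: "('a \<times> 'a) set \<Rightarrow> 'a set \<Rightarrow> 'a set \<Rightarrow> int" where
  "btw E X Y = int (card (E \<inter> X \<times> Y)) + int (card (E \<inter> Y \<times> X))"

text \<open>The goal is \<open>exc E W \<le> 1\<close> for connected \<open>W\<close>; extremal
  means equality. On parts without arcs between them \<open>exc\<close> is only subadditive, so the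
  ones add up.\<close>

definition exc :: "('a \<times> 'a) set \<Rightarrow> 'a set \<Rightarrow> int" where
  "exc E W = 7 * int (tau E W) - wt E W"

definition deg :: "('a \<times> 'a) set \<Rightarrow> 'a \<Rightarrow> nat" where
  "deg E v = card (E `` {v}) + card (E\<inverse> `` {v})"

text \<open>Connectivity of the underlying undirected graph, phrased by cuts: each use needs only an
  arc leaving a proper nonempty subset, so no paths are built.\<close>

definition conn :: "('a \<times> 'a) set \<Rightarrow> 'a set \<Rightarrow> bool" where
  "conn E W \<longleftrightarrow> W \<noteq> {} \<and>
     (\<forall>X. X \<subseteq> W \<longrightarrow> X \<noteq> {} \<longrightarrow> X \<noteq> W \<longrightarrow> (\<exists>x\<in>X. \<exists>y\<in>W - X. (x, y) \<in> E \<or> (y, x) \<in> E))"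

definition comps :: "('a \<times> 'a) set \<Rightarrow> 'a set \<Rightarrow> 'a set set" where
  "comps E W = {C. C \<subseteq> W \<and> conn E C \<and> (\<forall>x\<in>C. \<forall>y\<in>W - C. (x, y) \<notin> E \<and> (y, x) \<notin> E)}"

subsection \<open>Acyclicity and the feedback number\<close>

lemma acycI:
  fixes f :: "'a \<Rightarrow> nat"
  assumes "\<And>x y. x \<in> W \<Longrightarrow> y \<in> W \<Longrightarrow> (x, y) \<in> E \<Longrightarrow> f x < f y"
  shows "acyc E W"
  using assms unfolding acyc_def by blast

lemma acycE:
  assumes "acyc E W"
  obtains f :: "'a \<Rightarrow> nat" where "\<And>x y. x \<in> W \<Longrightarrow> y \<in> W \<Longrightarrow> (x, y) \<in> E \<Longrightarrow> f x < f y"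
  using assms unfolding acyc_def by blast

lemma acyc_subset:
  assumes "acyc E' W'" "W \<subseteq> W'" "\<And>x y. x \<in> W \<Longrightarrow> y \<in> W \<Longrightarrow> (x, y) \<in> E \<Longrightarrow> (x, y) \<in> E'"
  shows "acyc E W"
proof -
  obtain f :: "'a \<Rightarrow> nat" where f: "\<And>x y. x \<in> W' \<Longrightarrow> y \<in> W' \<Longrightarrow> (x, y) \<in> E' \<Longrightarrow> f x < f y"
    using acycE[OF assms(1)] by blast
  show ?thesis by (rule acycI[of W E f]) (use f assms(2,3) in blast)
qed

lemma acyc_mono: "acyc E W' \<Longrightarrow> W \<subseteq> W' \<Longrightarrow> acyc E W"
  by (rule acyc_subset)

text \<open>The pair \<open>(r, f)\<close> is packed into the single number
  \<open>r * M + f\<close>, with \<open>M\<close> above all values of \<open>f\<close> on the finite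
  set.\<close>

lemma acyc_lex:
  fixes r f :: "'a \<Rightarrow> nat"
  assumes "finite W"
    and step: "\<And>x y. x \<in> W \<Longrightarrow> y \<in> W \<Longrightarrow> (x, y) \<in> E \<Longrightarrow> r x < r y \<or> r x = r y \<and> f x < f y"
  shows "acyc E W"
proof -
  define M where "M = Suc (Max (f ` W))"
  have b: "f x < M" if "x \<in> W" for x
    using that assms(1) by (simp add: M_def less_Suc_eq_le)
  have "r x * M + f x < r y * M + f y" if "x \<in> W" "y \<in> W" "(x, y) \<in> E" for x y
  proof (cases "r x < r y")
    case True
    then have "Suc (r x) * M \<le> r y * M" by (intro mult_le_mono1) simp
    then show ?thesis using b[OF that(1)] by simp
  next
    case False
    then show ?thesis using step[OF that] by auto
  qed
  then show ?thesis by (rule acycI)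
qed

lemma acyc_converse:
  assumes "finite W" "acyc E W"
  shows "acyc (E\<inverse>) W"
proof -
  obtain f :: "'a \<Rightarrow> nat" where f: "\<And>x y. x \<in> W \<Longrightarrow> y \<in> W \<Longrightarrow> (x, y) \<in> E \<Longrightarrow> f x < f y"
    using acycE[OF assms(2)] by blast
  have b: "f x \<le> Max (f ` W)" if "x \<in> W" for x
    using that assms(1) by simp
  show ?thesis
  proof (rule acycI)
    fix x y assume xy: "x \<in> W" "y \<in> W" "(x, y) \<in> E\<inverse>"
    show "Max (f ` W) - f x < Max (f ` W) - f y"
      using f[of y x] b[of x] xy by auto
  qed
qed

text \<open>A rank of \<open>A\<close> in which every vertex that sends an arc to \<open>B\<close> lies below the threshold \<open>c\<close> and every
  vertex that receives one lies above it leaves no path of \<open>A\<close> from an entry to an exit.\<close>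

lemma acyc_threshold:
  fixes f :: "'a \<Rightarrow> nat"
  assumes fin: "finite A" "finite B"
    and f: "\<And>x y. x \<in> A \<Longrightarrow> y \<in> A \<Longrightarrow> (x, y) \<in> E \<Longrightarrow> f x < f y"
    and out: "\<And>x y. x \<in> A \<Longrightarrow> y \<in> B \<Longrightarrow> (x, y) \<in> E \<Longrightarrow> f x \<le> c"
    and inn: "\<And>x y. x \<in> A \<Longrightarrow> y \<in> B \<Longrightarrow> (y, x) \<in> E \<Longrightarrow> c < f x"
    and B: "acyc E B"
  shows "acyc E (A \<union> B)"
proof -
  obtain g :: "'a \<Rightarrow> nat" where g: "\<And>x y. x \<in> B \<Longrightarrow> y \<in> B \<Longrightarrow> (x, y) \<in> E \<Longrightarrow> g x < g y"
    using acycE[OF B] by blast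
  define r where "r x = (if x \<in> B then 1 else if f x \<le> c then 0 else 2 :: nat)" for x
  define h where "h x = (if x \<in> B then g x else f x)" for x
  show ?thesis
  proof (rule acyc_lex[of _ _ r h])
    fix x y assume xy: "x \<in> A \<union> B" "y \<in> A \<union> B" "(x, y) \<in> E"
    show "r x < r y \<or> r x = r y \<and> h x < h y"
      using xy f[of x y] out[of x y] inn[of y x] g[of x y] by (auto simp: r_def h_def)
  qed (use fin in simp)
qed

lemma acyc_Un_oneway:
  assumes "finite A" "finite B" "acyc E A" "acyc E B"
    and no: "\<And>x y. x \<in> A \<Longrightarrow> y \<in> B \<Longrightarrow> (y, x) \<notin> E"
  shows "acyc E (A \<union> B)"
proof -
  obtain f :: "'a \<Rightarrow> nat" where f: "\<And>x y. x \<in> A \<Longrightarrow> y \<in> A \<Longrightarrow> (x, y) \<in> E \<Longrightarrow> f x < f y"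
    using acycE[OF assms(3)] by blast
  \<comment> \<open>With the threshold at the maximum all of \<open>A\<close> lies at or below it,
    and the condition on arcs from \<open>B\<close> to \<open>A\<close> is vacuous.\<close>
  show ?thesis
    by (rule acyc_threshold[of A B E f "Max (f ` A)"]) (use assms f in auto)
qed

text \<open>Since \<open>w\<close> precedes \<open>w'\<close> in both ranks, splitting each rank at \<open>w\<close> and \<open>w'\<close> into five regions merges them.\<close>

lemma acyc_glue_arc:
  assumes fin: "finite A" "finite B" and AB: "A \<inter> B = {w, w'}" "(w, w') \<in> E" "(w', w) \<notin> E"
    and A: "acyc E A" and B: "acyc E B"
    and no: "\<And>x y. x \<in> A - B \<Longrightarrow> y \<in> B - A \<Longrightarrow> (x, y) \<notin> E \<and> (y, x) \<notin> E"
  shows "acyc E (A \<union> B)"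
proof -
  obtain f :: "'a \<Rightarrow> nat" where f: "\<And>x y. x \<in> A \<Longrightarrow> y \<in> A \<Longrightarrow> (x, y) \<in> E \<Longrightarrow> f x < f y"
    using acycE[OF A] by blast
  obtain g :: "'a \<Rightarrow> nat" where g: "\<And>x y. x \<in> B \<Longrightarrow> y \<in> B \<Longrightarrow> (x, y) \<in> E \<Longrightarrow> g x < g y"
    using acycE[OF B] by blast
  \<comment> \<open>Ties with \<open>w\<close> fall into region 0 and ties with \<open>w'\<close>
    into region 2. Equal ranks exclude an arc, so every arc moves to a later region or stays inside
    an even one.\<close>
  define reg :: "('a \<Rightarrow> nat) \<Rightarrow> 'a \<Rightarrow> nat" where
    "reg h x = (if x = w then 1 else if x = w' then 3 else if h x \<le> h w then 0
      else if h x \<le> h w' then 2 else 4)" for h x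
  define r where "r x = (if x \<in> A then reg f x else reg g x)" for x
  define h where "h x = (if x \<in> A then f x else g x)" for x
  have w: "w \<in> A" "w' \<in> A" "w \<in> B" "w' \<in> B" using AB(1) by auto
  have fw: "f w < f w'" "g w < g w'" using f g w AB(2) by auto
  have ww: "w \<noteq> w'" using AB by auto
  have regf: "reg f x < reg f y \<or> reg f x = reg f y \<and> f x < f y \<and> x \<notin> {w, w'} \<and> y \<notin> {w, w'}"
    if "x \<in> A" "y \<in> A" "(x, y) \<in> E" for x y
    using f[OF that] fw ww AB(3) that unfolding reg_def by (auto split: if_splits)
  have regg: "reg g x < reg g y \<or> reg g x = reg g y \<and> g x < g y \<and> x \<notin> {w, w'} \<and> y \<notin> {w, w'}"
    if "x \<in> B" "y \<in> B" "(x, y) \<in> E" for x y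
    using g[OF that] fw ww AB(3) that unfolding reg_def by (auto split: if_splits)
  have rB: "r x = reg g x" if "x \<in> B" for x
    using that AB(1) by (auto simp: r_def reg_def)
  have hB: "h x = g x" if "x \<in> B" "x \<notin> {w, w'}" for x
    using that AB(1) by (auto simp: h_def)
  show ?thesis
  proof (rule acyc_lex[of _ _ r h])
    fix x y assume xy: "x \<in> A \<union> B" "y \<in> A \<union> B" "(x, y) \<in> E"
    then consider "x \<in> A" "y \<in> A" | "x \<in> B" "y \<in> B"
      using no[of x y] no[of y x] by blast
    then show "r x < r y \<or> r x = r y \<and> h x < h y"
    proof cases
      case 1
      then show ?thesis using regf[OF 1 xy(3)] by (auto simp: r_def h_def)
    next
      case 2
      then show ?thesis using regg[OF 2 xy(3)] by (auto simp: rB hB)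
    qed
  qed (use fin in simp)
qed

lemma tau_le: "S \<subseteq> W \<Longrightarrow> acyc E (W - S) \<Longrightarrow> tau E W \<le> card S"
  unfolding tau_def by (rule Least_le) blast

lemma tau_attained:
  obtains S where "S \<subseteq> W" "acyc E (W - S)" "card S = tau E W"
proof -
  have "\<exists>k S. S \<subseteq> W \<and> acyc E (W - S) \<and> card S = k"
    by (rule exI, rule exI[of _ W]) (auto simp: acyc_def)
  from LeastI_ex[OF this] show ?thesis
    using that unfolding tau_def by blast
qed

lemma tau_acyc: "acyc E W \<Longrightarrow> tau E W = 0"
  using tau_le[of "{}" W E] by simp

lemma tau_subset:
  assumes "finite W'" "W \<subseteq> W'" "\<And>x y. x \<in> W \<Longrightarrow> y \<in> W \<Longrightarrow> (x, y) \<in> E \<Longrightarrow> (x, y) \<in> E'"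
  shows "tau E W \<le> tau E' W'"
proof -
  obtain S where S: "S \<subseteq> W'" "acyc E' (W' - S)" "card S = tau E' W'" by (rule tau_attained)
  have "acyc E (W - S \<inter> W)"
    by (rule acyc_subset[OF S(2)]) (use assms in auto)
  then have "tau E W \<le> card (S \<inter> W)" by (intro tau_le) auto
  also have "\<dots> \<le> card S" using S(1) assms(1) by (meson card_mono finite_subset inf_le1)
  finally show ?thesis using S(3) by simp
qed

lemma tau_delete:
  assumes "finite W" "K \<subseteq> W"
  shows "tau E W \<le> card K + tau E (W - K)"
proof -
  obtain S where S: "S \<subseteq> W - K" "acyc E (W - K - S)" "card S = tau E (W - K)" by (rule tau_attained)
  have "tau E W \<le> card (K \<union> S)"
    by (rule tau_le) (use S assms in \<open>auto simp: Diff_eq Int_assoc\<close>)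
  then show ?thesis using card_Un_le[of K S] S(3) by linarith
qed

lemma tau_Un_oneway:
  assumes "finite A" "finite B" "A \<inter> B = {}" and no: "\<And>x y. x \<in> A \<Longrightarrow> y \<in> B \<Longrightarrow> (y, x) \<notin> E"
  shows "tau E (A \<union> B) \<le> tau E A + tau E B"
proof -
  obtain S where S: "S \<subseteq> A" "acyc E (A - S)" "card S = tau E A" by (rule tau_attained)
  obtain T where T: "T \<subseteq> B" "acyc E (B - T)" "card T = tau E B" by (rule tau_attained)
  have "acyc E ((A - S) \<union> (B - T))"
    by (rule acyc_Un_oneway) (use assms S T in auto)
  moreover have "A \<union> B - (S \<union> T) = (A - S) \<union> (B - T)"
    using assms(3) S(1) T(1) by blast
  ultimately have "tau E (A \<union> B) \<le> card (S \<union> T)"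
    by (intro tau_le) (use S T in auto)
  then show ?thesis using card_Un_le[of S T] S(3) T(3) by linarith
qed

text \<open>A source lies on no directed cycle: it can be ranked below everything else.\<close>

lemma tau_source:
  assumes "finite W" "\<And>x. x \<in> W \<Longrightarrow> (x, v) \<notin> E"
  shows "tau E W \<le> tau E (W - {v})"
proof (cases "v \<in> W")
  case True
  have "acyc E {v}" using assms(2)[OF True] by (auto simp: acyc_def)
  then have "tau E ({v} \<union> (W - {v})) \<le> 0 + tau E (W - {v})"
    using tau_Un_oneway[of "{v}" "W - {v}" E] tau_acyc[of E "{v}"] assms by auto
  then show ?thesis using True by (simp add: insert_absorb)
qed simp

lemma tau_converse:
  assumes "finite W" shows "tau (E\<inverse>) W = tau E W"
proof -
  have "acyc (E\<inverse>) (W - S) \<longleftrightarrow> acyc E (W - S)" for S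
    using acyc_converse[of "W - S" E] acyc_converse[of "W - S" "E\<inverse>"] assms by auto
  then show ?thesis unfolding tau_def by simp
qed

lemma tau_sink:
  assumes "finite W" "\<And>x. x \<in> W \<Longrightarrow> (v, x) \<notin> E"
  shows "tau E W \<le> tau E (W - {v})"
  using tau_source[of W v "E\<inverse>"] assms by (simp add: tau_converse)

subsection \<open>Weights\<close>

lemma wt_Un:
  assumes "finite A" "finite B" "A \<inter> B = {}"
  shows "wt E (A \<union> B) = wt E A + wt E B + btw E A B"
proof -
  have *: "ind E (A \<union> B) = (ind E A \<union> ind E B) \<union> (E \<inter> A \<times> B \<union> E \<inter> B \<times> A)"
    by (auto simp: ind_def)
  have "card (ind E (A \<union> B)) = card (ind E A \<union> ind E B) + card (E \<inter> A \<times> B \<union> E \<inter> B \<times> A)"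
    unfolding * by (rule card_Un_disjoint) (use assms in \<open>auto simp: ind_def\<close>)
  moreover have "card (ind E A \<union> ind E B) = card (ind E A) + card (ind E B)"
    by (rule card_Un_disjoint) (use assms in \<open>auto simp: ind_def\<close>)
  moreover have "card (E \<inter> A \<times> B \<union> E \<inter> B \<times> A) = card (E \<inter> A \<times> B) + card (E \<inter> B \<times> A)"
    by (rule card_Un_disjoint) (use assms in auto)
  ultimately show ?thesis
    unfolding wt_def btw_def by (simp add: card_Un_disjoint assms)
qed

lemma wt_split:
  assumes "finite V" "Y \<subseteq> V"
  shows "wt E V = wt E Y + wt E (V - Y) + btw E Y (V - Y)"
  using wt_Un[of Y "V - Y" E] assms by (simp add: finite_subset Un_absorb1)

lemma btw_commute: "btw E X Y = btw E Y X"
  by (simp add: btw_def)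

lemma btw_Un_left:
  assumes "finite A" "finite B" "finite C" "A \<inter> B = {}"
  shows "btw E (A \<union> B) C = btw E A C + btw E B C"
proof -
  have "E \<inter> (A \<union> B) \<times> C = E \<inter> A \<times> C \<union> E \<inter> B \<times> C" "E \<inter> C \<times> (A \<union> B) = E \<inter> C \<times> A \<union> E \<inter> C \<times> B"
    by auto
  moreover have "card (E \<inter> A \<times> C \<union> E \<inter> B \<times> C) = card (E \<inter> A \<times> C) + card (E \<inter> B \<times> C)"
    by (rule card_Un_disjoint) (use assms in auto)
  moreover have "card (E \<inter> C \<times> A \<union> E \<inter> C \<times> B) = card (E \<inter> C \<times> A) + card (E \<inter> C \<times> B)"
    by (rule card_Un_disjoint) (use assms in auto)
  ultimately show ?thesis by (simp add: btw_def)
qed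

lemma btw_Un_right:
  assumes "finite A" "finite B" "finite C" "A \<inter> B = {}"
  shows "btw E C (A \<union> B) = btw E C A + btw E C B"
  using btw_Un_left[OF assms, of E] by (simp add: btw_commute)

lemma btw_nonneg: "0 \<le> btw E X Y" by (simp add: btw_def)

lemma btw_empty [simp]: "btw E {} Y = 0" "btw E Y {} = 0" by (simp_all add: btw_def)

lemma btw_0:
  assumes "\<And>x y. x \<in> X \<Longrightarrow> y \<in> Y \<Longrightarrow> (x, y) \<notin> E \<and> (y, x) \<notin> E"
  shows "btw E X Y = 0"
proof -
  have "E \<inter> X \<times> Y = {}" "E \<inter> Y \<times> X = {}" using assms by auto
  then show ?thesis by (simp add: btw_def)
qed

lemma btw_pos:
  assumes "finite X" "finite Y" "x \<in> X" "y \<in> Y" "(x, y) \<in> E \<or> (y, x) \<in> E"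
  shows "1 \<le> btw E X Y"
proof -
  have fin: "finite (E \<inter> X \<times> Y)" "finite (E \<inter> Y \<times> X)" using assms by auto
  have "E \<inter> X \<times> Y \<noteq> {} \<or> E \<inter> Y \<times> X \<noteq> {}" using assms by auto
  then have "card (E \<inter> X \<times> Y) > 0 \<or> card (E \<inter> Y \<times> X) > 0" using fin by (simp add: card_gt_0_iff)
  then show ?thesis by (auto simp: btw_def)
qed

lemma btw_eq_0D:
  assumes "finite X" "finite Y" "btw E X Y \<le> 0" "x \<in> X" "y \<in> Y"
  shows "(x, y) \<notin> E" "(y, x) \<notin> E"
  using btw_pos[of X Y x y E] assms by auto

lemma wt_converse: "wt (E\<inverse>) W = wt E W"
proof -
  have "ind (E\<inverse>) W = (ind E W)\<inverse>" by (auto simp: ind_def)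
  then show ?thesis by (simp add: wt_def card_inverse)
qed

lemma btw_converse: "btw (E\<inverse>) X Y = btw E X Y"
proof -
  have "E\<inverse> \<inter> X \<times> Y = (E \<inter> Y \<times> X)\<inverse>" "E\<inverse> \<inter> Y \<times> X = (E \<inter> X \<times> Y)\<inverse>" by auto
  then show ?thesis by (simp add: btw_def card_inverse)
qed

lemma exc_converse: "finite W \<Longrightarrow> exc (E\<inverse>) W = exc E W"
  by (simp add: exc_def tau_converse wt_converse)

lemma deg_converse: "deg (E\<inverse>) v = deg E v"
  by (simp add: deg_def)

lemma sum_card_Image:
  assumes "finite V" "E \<subseteq> V \<times> V" "Y \<subseteq> V"
  shows "(\<Sum>y\<in>Y. card (E `` {y})) = card (E \<inter> Y \<times> Y) + card (E \<inter> Y \<times> (V - Y))"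
proof -
  have fin: "finite (E `` {y})" for y
    by (rule finite_subset[of _ V]) (use assms in auto)
  have "(\<Sum>y\<in>Y. card (E `` {y})) = card (SIGMA y:Y. E `` {y})"
    using fin assms(1,3) by (simp add: card_SigmaI finite_subset)
  also have "(SIGMA y:Y. E `` {y}) = E \<inter> Y \<times> Y \<union> E \<inter> Y \<times> (V - Y)"
    using assms(2,3) by auto
  also have "card \<dots> = card (E \<inter> Y \<times> Y) + card (E \<inter> Y \<times> (V - Y))"
    by (rule card_Un_disjoint) (use assms in \<open>auto intro: finite_subset\<close>)
  finally show ?thesis .
qed

lemma handshake:
  assumes "finite V" "E \<subseteq> V \<times> V" "Y \<subseteq> V"
  shows "(\<Sum>y\<in>Y. int (deg E y)) = 2 * int (card (ind E Y)) + btw E Y (V - Y)"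
proof -
  have "E\<inverse> \<inter> Y \<times> Y = (E \<inter> Y \<times> Y)\<inverse>" "E\<inverse> \<inter> Y \<times> (V - Y) = (E \<inter> (V - Y) \<times> Y)\<inverse>" by auto
  then have c: "card (E\<inverse> \<inter> Y \<times> Y) = card (E \<inter> Y \<times> Y)"
    "card (E\<inverse> \<inter> Y \<times> (V - Y)) = card (E \<inter> (V - Y) \<times> Y)" by (simp_all add: card_inverse)
  have "(\<Sum>y\<in>Y. deg E y) = (\<Sum>y\<in>Y. card (E `` {y})) + (\<Sum>y\<in>Y. card (E\<inverse> `` {y}))"
    by (simp add: deg_def sum.distrib)
  then have "(\<Sum>y\<in>Y. deg E y) = 2 * card (E \<inter> Y \<times> Y) + card (E \<inter> Y \<times> (V - Y)) + card (E \<inter> (V - Y) \<times> Y)"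
    using sum_card_Image[OF assms] sum_card_Image[of V "E\<inverse>" Y] assms c by auto
  moreover have "(\<Sum>y\<in>Y. int (deg E y)) = int (\<Sum>y\<in>Y. deg E y)" by simp
  ultimately show ?thesis by (simp add: btw_def ind_def)
qed

subsection \<open>Connected vertex sets and components\<close>

lemma connD:
  assumes "conn E W" "X \<subseteq> W" "X \<noteq> {}" "X \<noteq> W"
  obtains x y where "x \<in> X" "y \<in> W" "y \<notin> X" "(x, y) \<in> E \<or> (y, x) \<in> E"
  using assms unfolding conn_def by blast

lemma conn_nonempty: "conn E W \<Longrightarrow> W \<noteq> {}" by (simp add: conn_def)

lemma conn_singleton [simp]: "conn E {v}" by (auto simp: conn_def)

lemma conn_converse [simp]: "conn (E\<inverse>) W = conn E W"
  unfolding conn_def by auto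

lemma conn_Un:
  assumes C: "conn E C" and D: "conn E D"
    and "C \<inter> D \<noteq> {} \<or> (\<exists>x\<in>C. \<exists>y\<in>D. (x, y) \<in> E \<or> (y, x) \<in> E)"
  shows "conn E (C \<union> D)"
  unfolding conn_def
proof (intro conjI allI impI)
  show "C \<union> D \<noteq> {}" using C by (auto simp: conn_def)
  fix X assume X: "X \<subseteq> C \<union> D" "X \<noteq> {}" "X \<noteq> C \<union> D"
  show "\<exists>x\<in>X. \<exists>y\<in>C \<union> D - X. (x, y) \<in> E \<or> (y, x) \<in> E"
  proof (cases "(X \<inter> C = {} \<or> X \<inter> C = C) \<and> (X \<inter> D = {} \<or> X \<inter> D = D)")
    case True
    then show ?thesis using X assms(3) by blast
  next
    case False
    then consider "X \<inter> C \<noteq> {}" "X \<inter> C \<noteq> C" | "X \<inter> D \<noteq> {}" "X \<inter> D \<noteq> D" by blast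
    then show ?thesis
    proof cases
      case 1
      then obtain x y where "x \<in> X \<inter> C" "y \<in> C" "y \<notin> X \<inter> C" "(x, y) \<in> E \<or> (y, x) \<in> E"
        using connD[OF C, of "X \<inter> C"] by blast
      then show ?thesis by blast
    next
      case 2
      then obtain x y where "x \<in> X \<inter> D" "y \<in> D" "y \<notin> X \<inter> D" "(x, y) \<in> E \<or> (y, x) \<in> E"
        using connD[OF D, of "X \<inter> D"] by blast
      then show ?thesis by blast
    qed
  qed
qed

lemma conn_insert:
  assumes "conn E C" "x \<in> C" "(x, v) \<in> E \<or> (v, x) \<in> E"
  shows "conn E (insert v C)"
  using conn_Un[OF assms(1) conn_singleton, of v] assms(2,3) by auto

lemma compsD:
  assumes "C \<in> comps E W"
  shows "C \<subseteq> W" "conn E C" "\<And>x y. x \<in> C \<Longrightarrow> y \<in> W \<Longrightarrow> y \<notin> C \<Longrightarrow> (x, y) \<notin> E \<and> (y, x) \<notin> E"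
  using assms by (auto simp: comps_def)

lemma comps_subset_conn:
  assumes C: "C \<in> comps E W" and K: "conn E K" "K \<subseteq> W" "K \<inter> C \<noteq> {}"
  shows "K \<subseteq> C"
proof (rule ccontr)
  assume "\<not> K \<subseteq> C"
  then obtain x y where "x \<in> K \<inter> C" "y \<in> K" "y \<notin> K \<inter> C" "(x, y) \<in> E \<or> (y, x) \<in> E"
    using connD[OF K(1), of "K \<inter> C"] K(3) by blast
  then show False using compsD(3)[OF C, of x y] K(2) by blast
qed

lemma comps_disjoint:
  assumes "C \<in> comps E W" "D \<in> comps E W" "C \<noteq> D"
  shows "C \<inter> D = {}"
  using comps_subset_conn[OF assms(1) compsD(2,1)[OF assms(2)]]
    comps_subset_conn[OF assms(2) compsD(2,1)[OF assms(1)]] assms(3) by blast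

lemma comps_cover:
  assumes "finite W" "x \<in> W"
  obtains C where "C \<in> comps E W" "x \<in> C"
proof -
  define P where "P Z \<longleftrightarrow> Z \<subseteq> W \<and> x \<in> Z \<and> (\<forall>a\<in>Z. \<forall>b\<in>W - Z. (a, b) \<notin> E \<and> (b, a) \<notin> E)" for Z
  have "P W" using assms by (auto simp: P_def)
  then obtain Z where Z: "P Z" and min: "\<And>Z'. P Z' \<Longrightarrow> card Z \<le> card Z'"
    using ex_has_least_nat[of P W card] by blast
  have fZ: "finite Z" using Z assms(1) unfolding P_def by (blast intro: finite_subset)
  have "conn E Z"
    unfolding conn_def
  proof (intro conjI allI impI)
    show "Z \<noteq> {}" using Z by (auto simp: P_def)
    fix X assume X: "X \<subseteq> Z" "X \<noteq> {}" "X \<noteq> Z"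
    show "\<exists>a\<in>X. \<exists>b\<in>Z - X. (a, b) \<in> E \<or> (b, a) \<in> E"
    proof (rule ccontr)
      assume neg: "\<not> ?thesis"
      define X' where "X' = (if x \<in> X then X else Z - X)"
      have X': "X' \<subset> Z" using X by (auto simp: X'_def)
      have no: "(a, b) \<notin> E \<and> (b, a) \<notin> E" if "a \<in> X'" "b \<in> W - X'" for a b
      proof (cases "b \<in> Z")
        case True
        then show ?thesis using that neg X(1) by (cases "x \<in> X") (auto simp: X'_def)
      next
        case False
        then show ?thesis using that X' Z unfolding P_def by blast
      qed
      have "P X'" using no X' Z unfolding P_def by (auto simp: X'_def)
      then show False using min[of X'] psubset_card_mono[OF fZ X'] by simp
    qed
  qed
  then have "Z \<in> comps E W" using Z by (auto simp: P_def comps_def)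
  then show ?thesis using that Z by (auto simp: P_def)
qed

lemma comps_super:
  assumes "finite W" "conn E K" "K \<subseteq> W"
  obtains C where "C \<in> comps E W" "K \<subseteq> C"
proof -
  obtain x where x: "x \<in> K" using assms(2) by (auto simp: conn_def)
  then obtain C where C: "C \<in> comps E W" "x \<in> C" using comps_cover[OF assms(1)] assms(3) by blast
  then have "K \<subseteq> C" using comps_subset_conn[OF C(1) assms(2,3)] x by blast
  then show ?thesis using that C by blast
qed

lemma finite_comps: "finite W \<Longrightarrow> finite (comps E W)"
  by (rule finite_subset[of _ "Pow W"]) (auto simp: comps_def)

lemma comps_empty [simp]: "comps E {} = {}"
  by (auto simp: comps_def conn_def)

lemma comps_conn: "conn E W \<Longrightarrow> comps E W = {W}"
proof
  assume W: "conn E W"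
  show W': "{W} \<subseteq> comps E W" using W by (auto simp: comps_def)
  show "comps E W \<subseteq> {W}"
  proof
    fix C assume C: "C \<in> comps E W"
    then have "C \<inter> W \<noteq> {}" using compsD(1,2)[OF C] by (auto simp: conn_def)
    then show "C \<in> {W}" using comps_disjoint[OF C, of W] W' by auto
  qed
qed

lemma comps_remove:
  assumes C: "C \<in> comps E W"
  shows "comps E W = insert C (comps E (W - C))" "C \<notin> comps E (W - C)"
proof -
  show "C \<notin> comps E (W - C)" using compsD(1,2)[of C E "W - C"] by (auto simp: conn_def)
  show "comps E W = insert C (comps E (W - C))"
  proof (intro equalityI subsetI)
    fix D assume D: "D \<in> comps E W"
    show "D \<in> insert C (comps E (W - C))"
      using comps_disjoint[OF C D] D by (auto simp: comps_def)
  next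
    fix D assume "D \<in> insert C (comps E (W - C))"
    then consider "D = C" | "D \<in> comps E (W - C)" by blast
    then show "D \<in> comps E W"
    proof cases
      case 2
      then have "(x, y) \<notin> E \<and> (y, x) \<notin> E" if "x \<in> D" "y \<in> W - D" for x y
        using compsD(3)[OF 2, of x y] compsD(1)[OF 2] compsD(3)[OF C, of y x] that by blast
      then show ?thesis using compsD[OF 2] unfolding comps_def by blast
    qed (use C in simp)
  qed
qed

text \<open>One induction serves \<open>exc\<close>, \<open>btw\<close> and the final bound. An
  equality, as for \<open>btw\<close>, is obtained by applying it to the function and to its
  negative.\<close>

lemma comps_sum:
  assumes "finite W" "f {} = (0 :: int)"
    and "\<And>A B. A \<subseteq> W \<Longrightarrow> B \<subseteq> W \<Longrightarrow> A \<inter> B = {} \<Longrightarrow>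
      (\<And>x y. x \<in> A \<Longrightarrow> y \<in> B \<Longrightarrow> (x, y) \<notin> E \<and> (y, x) \<notin> E) \<Longrightarrow> f (A \<union> B) \<le> f A + f B"
  shows "f W \<le> (\<Sum>C\<in>comps E W. f C)"
  using assms
proof (induction "card W" arbitrary: W rule: less_induct)
  case less
  show ?case
  proof (cases "W = {}")
    case True
    then show ?thesis using less.prems(2) by simp
  next
    case False
    then obtain C where C: "C \<in> comps E W" using comps_cover[OF less.prems(1), of _ E] by blast
    have CW: "C \<subseteq> W" "C \<noteq> {}" using compsD(1,2)[OF C] by (auto simp: conn_def)
    have "f (C \<union> (W - C)) \<le> f C + f (W - C)"
      by (rule less.prems(3)) (use CW compsD(3)[OF C] in auto)
    moreover have "f (W - C) \<le> (\<Sum>C\<in>comps E (W - C). f C)"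
    proof (rule less.hyps)
      show "card (W - C) < card W"
        by (rule psubset_card_mono) (use less.prems(1) CW in auto)
    qed (use less.prems(1,2) less.prems(3) in \<open>blast+\<close>)
    moreover have "(\<Sum>C\<in>comps E W. f C) = f C + (\<Sum>C\<in>comps E (W - C). f C)"
      unfolding comps_remove(1)[OF C]
      by (rule sum.insert) (use comps_remove(2)[OF C] finite_comps less.prems(1) in auto)
    moreover have "C \<union> (W - C) = W" using CW by blast
    ultimately show ?thesis by simp
  qed
qed

lemma exc_le_sum:
  assumes "finite W" shows "exc E W \<le> (\<Sum>C\<in>comps E W. exc E C)"
proof (rule comps_sum[OF assms])
  show "exc E {} = 0" by (simp add: exc_def wt_def ind_def tau_acyc acyc_def)
  fix A B assume AB: "A \<subseteq> W" "B \<subseteq> W" "A \<inter> B = {}"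
    and no: "\<And>x y. x \<in> A \<Longrightarrow> y \<in> B \<Longrightarrow> (x, y) \<notin> E \<and> (y, x) \<notin> E"
  have fin: "finite A" "finite B" using AB assms by (auto intro: finite_subset)
  have "tau E (A \<union> B) \<le> tau E A + tau E B"
    by (rule tau_Un_oneway[OF fin AB(3)]) (use no in blast)
  moreover have "wt E (A \<union> B) = wt E A + wt E B"
    using wt_Un[OF fin AB(3), of E] btw_0[of A B E] no by simp
  ultimately show "exc E (A \<union> B) \<le> exc E A + exc E B" by (simp add: exc_def)
qed

lemma btw_sum_comps:
  assumes "finite W" "finite Y"
  shows "(\<Sum>C\<in>comps E W. btw E C Y) = btw E W Y"
proof (rule antisym)
  show "btw E W Y \<le> (\<Sum>C\<in>comps E W. btw E C Y)"
    by (rule comps_sum[OF assms(1)]) (use assms in \<open>auto simp: btw_Un_left finite_subset\<close>)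
  have "- btw E W Y \<le> (\<Sum>C\<in>comps E W. - btw E C Y)"
    by (rule comps_sum[OF assms(1)]) (use assms in \<open>auto simp: btw_Un_left finite_subset\<close>)
  then show "(\<Sum>C\<in>comps E W. btw E C Y) \<le> btw E W Y"
    by (simp add: sum_negf)
qed

text \<open>Each deletion costs 7, while the weight of \<open>Y\<close> and of its boundary arcs is
  gained; the balance has to be absorbed by the components.\<close>

lemma exc_delete:
  assumes "finite V" "Y \<subseteq> V" "tau E V \<le> k + tau E (V - Y)"
  shows "exc E V + wt E Y + btw E Y (V - Y) - 7 * int k \<le> (\<Sum>C\<in>comps E (V - Y). exc E C)"
  using exc_le_sum[of "V - Y" E] wt_split[OF assms(1,2), of E] assms(1,3) by (simp add: exc_def)

lemma comps_attached:
  assumes "finite V" "conn E V" "Y \<subseteq> V" "Y \<noteq> {}" "C \<in> comps E (V - Y)"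
  shows "1 \<le> btw E C Y" "btw E C (V - C) = btw E C Y"
    "\<exists>x\<in>C. \<exists>y\<in>Y. (x, y) \<in> E \<or> (y, x) \<in> E"
proof -
  have C: "C \<subseteq> V - Y" "C \<noteq> {}" using compsD(1,2)[OF assms(5)] by (auto simp: conn_def)
  then have "C \<subseteq> V" "C \<noteq> V" using assms(3,4) by auto
  then obtain x y where xy: "x \<in> C" "y \<in> V" "y \<notin> C" "(x, y) \<in> E \<or> (y, x) \<in> E"
    using connD[OF assms(2), of C] C(2) by blast
  then have "y \<in> Y" using compsD(3)[OF assms(5), of x y] by blast
  then show "\<exists>x\<in>C. \<exists>y\<in>Y. (x, y) \<in> E \<or> (y, x) \<in> E" using xy by blast
  have fin: "finite C" "finite Y" "finite (V - Y - C)" using C assms(1,3) by (auto intro: finite_subset)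
  show "1 \<le> btw E C Y" using btw_pos[OF fin(1,2) xy(1) \<open>y \<in> Y\<close> xy(4)] .
  have "V - C = Y \<union> (V - Y - C)" using C assms(3) by auto
  moreover have "btw E C (V - Y - C) = 0"
    by (rule btw_0) (use compsD(3)[OF assms(5)] in auto)
  ultimately show "btw E C (V - C) = btw E C Y"
    using btw_Un_right[of Y "V - Y - C" C E] fin by auto
qed

lemma card_comps_le_btw:
  assumes "finite V" "conn E V" "Y \<subseteq> V" "Y \<noteq> {}"
  shows "int (card (comps E (V - Y))) \<le> btw E Y (V - Y)"
proof -
  have "(\<Sum>C\<in>comps E (V - Y). 1) \<le> (\<Sum>C\<in>comps E (V - Y). btw E C Y)"
    by (rule sum_mono) (rule comps_attached(1)[OF assms])
  also have "\<dots> = btw E Y (V - Y)"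
    using btw_sum_comps[of "V - Y" Y E] assms by (simp add: finite_subset btw_commute)
  finally show ?thesis by simp
qed

subsection \<open>The minimal counterexample\<close>

lemma conn_subrel:
  assumes "conn E C" "\<And>x y. x \<in> C \<Longrightarrow> y \<in> C \<Longrightarrow> (x, y) \<in> E \<Longrightarrow> (x, y) \<in> E'"
  shows "conn E' C"
  unfolding conn_def
proof (intro conjI allI impI)
  show "C \<noteq> {}" using assms(1) by (simp add: conn_def)
  fix X assume X: "X \<subseteq> C" "X \<noteq> {}" "X \<noteq> C"
  then obtain x y where "x \<in> X" "y \<in> C" "y \<notin> X" "(x, y) \<in> E \<or> (y, x) \<in> E"
    using connD[OF assms(1), of X] by blast
  then show "\<exists>x\<in>X. \<exists>y\<in>C - X. (x, y) \<in> E' \<or> (y, x) \<in> E'"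
    using assms(2) X(1) by blast
qed

lemma card_ind_le:
  assumes fin: "finite Y" and asym: "\<And>x y. (x, y) \<in> E \<Longrightarrow> (y, x) \<notin> E"
  shows "2 * card (ind E Y) \<le> card Y * (card Y - 1)"
proof -
  have "card (ind E Y \<union> (ind E Y)\<inverse>) = card (ind E Y) + card ((ind E Y)\<inverse>)"
    by (rule card_Un_disjoint) (use fin asym in \<open>auto simp: ind_def\<close>)
  moreover have "ind E Y \<union> (ind E Y)\<inverse> \<subseteq> Y \<times> Y - Id_on Y"
    using asym by (auto simp: ind_def)
  then have "card (ind E Y \<union> (ind E Y)\<inverse>) \<le> card (Y \<times> Y - Id_on Y)"
    by (rule card_mono[rotated]) (use fin in auto)
  moreover have "card (Y \<times> Y - Id_on Y) = card Y * card Y - card Y"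
  proof -
    have "Id_on Y = (\<lambda>y. (y, y)) ` Y" by auto
    then have "card (Id_on Y) = card Y" by (simp add: card_image inj_on_def)
    then show ?thesis using fin
      by (subst card_Diff_subset) (auto simp: Id_on_def card_cartesian_product)
  qed
  ultimately show ?thesis by (simp add: card_inverse diff_mult_distrib2)
qed

text \<open>\<open>small\<close> ranges over all asymmetric relations on smaller sets, not only over
  subgraphs of \<open>E\<close>, because it is applied to contracted graphs and to graphs with
  auxiliary arcs.\<close>

locale mincex =
  fixes E :: "('a \<times> 'a) set" and V :: "'a set"
  assumes finV: "finite V" and EV: "E \<subseteq> V \<times> V" and asym: "\<And>x y. (x, y) \<in> E \<Longrightarrow> (y, x) \<notin> E"
    and connV: "conn E V" and excV: "2 \<le> exc E V"
    and small: "\<And>(E' :: ('a \<times> 'a) set) W. finite W \<Longrightarrow> card W < card V \<Longrightarrow> (\<And>x y. (x, y) \<in> E' \<Longrightarrow> (y, x) \<notin> E') \<Longrightarrow>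
      conn E' W \<Longrightarrow> exc E' W \<le> 1"
begin

lemma dual: "mincex (E\<inverse>) V"
proof
  show "2 \<le> exc (E\<inverse>) V" using excV finV by (simp add: exc_converse)
  show "conn (E\<inverse>) V" using connV by simp
qed (use finV EV asym small in auto)

lemma irrefl: "(x, x) \<notin> E" using asym by blast

lemma inV: "(x, y) \<in> E \<Longrightarrow> x \<in> V" "(x, y) \<in> E \<Longrightarrow> y \<in> V" using EV by auto

lemma fin: "X \<subseteq> V \<Longrightarrow> finite X" using finV by (rule finite_subset[rotated])

lemma fin_nbrs: "finite (E `` X)" "finite (E\<inverse> `` X)"
  by (rule fin; use EV in auto)+

lemma exc_sub: "C \<subseteq> V \<Longrightarrow> C \<noteq> V \<Longrightarrow> conn E C \<Longrightarrow> exc E C \<le> 1"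
  by (rule small) (use finV asym in \<open>auto intro: fin psubset_card_mono\<close>)

lemma exc_comp:
  assumes "Y \<subseteq> V" "Y \<noteq> {}" "C \<in> comps E (V - Y)"
  shows "exc E C \<le> 1"
  by (rule exc_sub) (use assms compsD(1,2)[OF assms(3)] in auto)

lemma sum_exc_comps_ge:
  assumes "Y \<subseteq> V" "tau E V \<le> k + tau E (V - Y)"
  shows "2 + wt E Y + btw E Y (V - Y) - 7 * int k \<le> (\<Sum>C\<in>comps E (V - Y). exc E C)"
  using exc_delete[OF finV assms] excV by linarith

text \<open>Every component has \<open>exc\<close> at most 1 and uses up at least one arc to
  \<open>Y\<close>, so the boundary term pays for all the ones and cancels.\<close>

lemma wt_le_of_delete:
  assumes "Y \<subseteq> V" "Y \<noteq> {}" "tau E V \<le> k + tau E (V - Y)"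
  shows "wt E Y + 2 \<le> 7 * int k"
proof -
  have "(\<Sum>C\<in>comps E (V - Y). exc E C) \<le> (\<Sum>C\<in>comps E (V - Y). 1)"
    by (rule sum_mono) (rule exc_comp[OF assms(1,2)])
  also have "\<dots> \<le> btw E Y (V - Y)"
    using card_comps_le_btw[OF finV connV assms(1,2)] by simp
  finally show ?thesis using sum_exc_comps_ge[OF assms(1,3)] by linarith
qed

lemma wt_singleton: "wt E {v} = 1"
proof -
  have "ind E {v} = {}" using irrefl by (auto simp: ind_def)
  then show ?thesis by (simp add: wt_def)
qed

lemma in_nonempty:
  assumes "v \<in> V" obtains u where "(u, v) \<in> E"
proof -
  have False if "\<And>u. (u, v) \<notin> E"
  proof -
    have "tau E V \<le> 0 + tau E (V - {v})" using tau_source[of V v E] finV that by simp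
    from wt_le_of_delete[OF _ _ this] show False using assms wt_singleton[of v] by simp
  qed
  then show ?thesis using that by blast
qed

lemma out_nonempty:
  assumes "v \<in> V" obtains u where "(v, u) \<in> E"
proof -
  interpret d: mincex "E\<inverse>" V by (rule dual)
  show ?thesis using d.in_nonempty[OF assms] that by blast
qed

lemma btw_singleton: "v \<in> V \<Longrightarrow> btw E {v} (V - {v}) = int (deg E v)"
  using handshake[OF finV EV, of "{v}"] irrefl by (simp add: ind_def)

text \<open>Route everything outside \<open>C\<close> through two new vertices \<open>s\<close>, \<open>t\<close>: an arc from \<open>t\<close> to \<open>s\<close>, arcs from \<open>s\<close> to
  the entries of \<open>C\<close> and from the exits of \<open>C\<close> to \<open>t\<close>. If this does not raise the feedback number of \<open>C\<close>, then an
  optimal set of \<open>C\<close> cuts all passages through \<open>C\<close> and can be combined with one of the rest.\<close>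

lemma exc_attached:
  assumes C: "conn E C" "C \<subseteq> V" and card3: "3 \<le> card (V - C)"
  shows "exc E C \<le> btw E C (V - C) - 3"
proof -
  obtain s t where st: "s \<in> V - C" "t \<in> V - C" "s \<noteq> t"
  proof -
    have "\<exists>s t. s \<in> V - C \<and> t \<in> V - C \<and> s \<noteq> t"
    proof (rule ccontr)
      assume "\<not> ?thesis"
      then have "card (V - C) \<le> Suc 0" by (subst card_le_Suc0_iff_eq) (use finV in auto)
      then show False using card3 by simp
    qed
    then show ?thesis using that by blast
  qed
  define Ent where "Ent = {x \<in> C. \<exists>y\<in>V - C. (y, x) \<in> E}"
  define Ext where "Ext = {x \<in> C. \<exists>y\<in>V - C. (x, y) \<in> E}"
  define E' where "E' = ind E C \<union> {(t, s)} \<union> {s} \<times> Ent \<union> Ext \<times> {t}"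
  define W where "W = insert s (insert t C)"
  have finC: "finite C" using C(2) by (rule fin)
  have finE: "finite Ent" "finite Ext" using finC by (auto simp: Ent_def Ext_def)
  have sub: "Ent \<subseteq> C" "Ext \<subseteq> C" by (auto simp: Ent_def Ext_def)
  have C0: "C \<noteq> {}" "C \<noteq> V" using C(1) st by (auto simp: conn_def)
  have cardV: "card V = card C + card (V - C)"
    using C(2) finC finV by (simp add: card_Diff_subset card_mono)
  \<comment> \<open>At least three outside vertices are replaced by the two vertices
    \<open>s\<close> and \<open>t\<close>, so minimality applies to \<open>W\<close>.\<close>
  have cardW: "card W < card V" using st finC card3 cardV by (simp add: W_def)
  have finW: "finite W" using finC by (simp add: W_def)
  have asym': "(y, x) \<notin> E'" if "(x, y) \<in> E'" for x y
    using that asym[of x y] st sub by (auto simp: E'_def ind_def)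
  have connC: "conn E' C"
    by (rule conn_subrel[OF C(1)]) (auto simp: E'_def ind_def)
  have connW: "conn E' W"
  proof -
    obtain x y where "x \<in> C" "y \<in> V - C" "(x, y) \<in> E \<or> (y, x) \<in> E"
      using connD[OF connV C(2) C0] by blast
    then consider "x \<in> Ent" | "x \<in> Ext" by (auto simp: Ent_def Ext_def)
    then show ?thesis
    proof cases
      case 1
      then have "conn E' (insert t (insert s C))"
        using sub by (intro conn_insert[of _ "insert s C" s] conn_insert[of _ C x] connC) (auto simp: E'_def)
      then show ?thesis by (simp add: W_def insert_commute)
    next
      case 2
      then show ?thesis unfolding W_def
        using sub by (intro conn_insert[of _ "insert t C" t] conn_insert[of _ C x] connC) (auto simp: E'_def)
    qed
  qed
  have "exc E' W \<le> 1" by (rule small[OF finW cardW _ connW]) (use asym' in blast)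
  \<comment> \<open>The 3 counts \<open>s\<close>, \<open>t\<close> and the arc
    \<open>(t, s)\<close>. Entries and exits are no more numerous than the boundary arcs in the
    respective direction.\<close>
  moreover have "wt E' W \<le> wt E C + 3 + btw E C (V - C)"
  proof -
    have "card (ind E' W) \<le> card (ind E C \<union> {(t, s)} \<union> {s} \<times> Ent \<union> Ext \<times> {t})"
      by (rule card_mono) (use finC finE in \<open>auto simp: E'_def ind_def\<close>)
    also have "\<dots> \<le> card (ind E C) + card {(t, s)} + card ({s} \<times> Ent) + card (Ext \<times> {t})"
      by (intro order_trans[OF card_Un_le] add_mono) auto
    also have "\<dots> = card (ind E C) + 1 + card Ent + card Ext" by (simp add: card_cartesian_product)
    finally have 1: "card (ind E' W) \<le> card (ind E C) + 1 + card Ent + card Ext" .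
    have "Ent = snd ` (E \<inter> (V - C) \<times> C)" by (force simp: Ent_def)
    then have 2: "card Ent \<le> card (E \<inter> (V - C) \<times> C)" using finC finV by (auto intro: card_image_le)
    have "Ext = fst ` (E \<inter> C \<times> (V - C))" by (force simp: Ext_def)
    then have 3: "card Ext \<le> card (E \<inter> C \<times> (V - C))" using finC finV by (auto intro: card_image_le)
    have "card W = card C + 2" using st finC by (simp add: W_def)
    then show ?thesis using 1 2 3 by (simp add: wt_def btw_def)
  qed
  ultimately have up: "7 * int (tau E' W) \<le> wt E C + btw E C (V - C) + 4" by (simp add: exc_def)
  \<comment> \<open>If \<open>W\<close> needs one deletion more than \<open>C\<close>, then
    \<open>7 * tau E C + 7 \<le> wt E C + btw E C (V - C) + 4\<close>, which is the claim.\<close>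
  have "\<not> tau E' W \<le> tau E C"
  proof
    assume le: "tau E' W \<le> tau E C"
    obtain S where S: "S \<subseteq> W" "acyc E' (W - S)" "card S = tau E' W" by (rule tau_attained)
    have "acyc E (C - S \<inter> C)"
      by (rule acyc_subset[OF S(2)]) (auto simp: W_def E'_def ind_def)
    then have "tau E C \<le> card (S \<inter> C)" by (intro tau_le) auto
    then have "card S \<le> card (S \<inter> C)" using le S(3) by simp
    then have "S \<inter> C = S" using S(1) finW by (intro card_seteq) (auto intro: finite_subset)
    then have SC: "S \<subseteq> C" by blast
    obtain f :: "'a \<Rightarrow> nat" where
      f: "\<And>x y. x \<in> W - S \<Longrightarrow> y \<in> W - S \<Longrightarrow> (x, y) \<in> E' \<Longrightarrow> f x < f y"
      using acycE[OF S(2)] by blast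
    obtain T where T: "T \<subseteq> V - C" "acyc E (V - C - T)" "card T = tau E (V - C)" by (rule tau_attained)
    \<comment> \<open>The arc \<open>(t, s)\<close> gives \<open>f t < f s\<close>, so the surviving
      exits lie below \<open>f t\<close> and the surviving entries above it: a threshold.\<close>
    have "acyc E ((C - S) \<union> (V - C - T))"
    proof (rule acyc_threshold[of _ _ _ f "f t"])
      show "f x < f y" if "x \<in> C - S" "y \<in> C - S" "(x, y) \<in> E" for x y
        using f[of x y] that by (auto simp: W_def E'_def ind_def)
      show "f x \<le> f t" if "x \<in> C - S" "y \<in> V - C - T" "(x, y) \<in> E" for x y
      proof -
        have "x \<in> Ext" using that by (auto simp: Ext_def)
        then have "f x < f t" using that st SC by (intro f) (auto simp: W_def E'_def)
        then show ?thesis by simp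
      qed
      show "f t < f x" if "x \<in> C - S" "y \<in> V - C - T" "(y, x) \<in> E" for x y
      proof -
        have "x \<in> Ent" using that by (auto simp: Ent_def)
        then have "f t < f s" "f s < f x" using that st SC by (auto intro!: f simp: W_def E'_def)
        then show ?thesis by simp
      qed
    qed (use finC finV T in auto)
    moreover have "V - (S \<union> T) = (C - S) \<union> (V - C - T)" using SC C(2) T(1) by blast
    ultimately have "tau E V \<le> card (S \<union> T)" using SC C(2) T(1) by (intro tau_le) auto
    also have "\<dots> \<le> tau E C + tau E (V - C)" using card_Un_le[of S T] S(3) T(3) le by linarith
    finally have "exc E V \<le> exc E C + exc E (V - C) - btw E C (V - C)"
      using wt_split[OF finV C(2), of E] by (simp add: exc_def)
    moreover have "exc E (V - C) \<le> btw E C (V - C)"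
    proof -
      have "exc E (V - C) \<le> (\<Sum>D\<in>comps E (V - C). exc E D)" using exc_le_sum finV by blast
      also have "\<dots> \<le> (\<Sum>D\<in>comps E (V - C). 1)"
        by (rule sum_mono) (rule exc_comp[OF C(2) C0(1)])
      also have "\<dots> \<le> btw E C (V - C)" using card_comps_le_btw[OF finV connV C(2) C0(1)] by simp
      finally show ?thesis .
    qed
    ultimately show False using exc_sub[OF C(2) C0(2) C(1)] excV by linarith
  qed
  then show ?thesis using up by (simp add: exc_def)
qed

text \<open>At a cut vertex each component leaves three vertices outside, so its \<open>exc\<close>
  is at most its number of arcs to \<open>v\<close> minus 3. With c components and b arcs at
  \<open>v\<close> this gives b - 4 \<le> b - 3 c, hence c \<le> 1.\<close>

lemma conn_delete:
  assumes v: "v \<in> V" shows "conn E (V - {v})"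
proof (rule ccontr)
  assume neg: "\<not> conn E (V - {v})"
  have ex: "exc E C \<le> btw E C {v} - 3" if C: "C \<in> comps E (V - {v})" for C
  proof -
    note D = compsD[OF C]
    have "C \<noteq> V - {v}" using D(2) neg by auto
    then obtain w where w: "w \<in> V" "w \<noteq> v" "w \<notin> C" using D(1) by auto
    \<comment> \<open>\<open>w\<close> has an in-neighbour and an out-neighbour, and they differ.
      One of them is not \<open>v\<close>; being adjacent to \<open>w\<close>, it lies outside
      \<open>C\<close> too.\<close>
    have "\<exists>z. z \<in> V \<and> z \<noteq> v \<and> z \<noteq> w \<and> z \<notin> C"
    proof (rule ccontr)
      assume "\<not> ?thesis"
      then have *: "z = v" if "(z, w) \<in> E \<or> (w, z) \<in> E" for z
        using that D(3)[of z w] w irrefl inV[of z w] inV[of w z] by auto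
      obtain a where "(a, w) \<in> E" using in_nonempty[OF w(1)] .
      moreover obtain b where "(w, b) \<in> E" using out_nonempty[OF w(1)] .
      ultimately show False using *[of a] *[of b] asym by auto
    qed
    then obtain z where z: "z \<in> V" "z \<noteq> v" "z \<noteq> w" "z \<notin> C" by blast
    have "card {v, w, z} \<le> card (V - C)"
      by (rule card_mono) (use finV v w z D(1) in auto)
    then have "3 \<le> card (V - C)" using w z by auto
    then have "exc E C \<le> btw E C (V - C) - 3" by (intro exc_attached) (use D in auto)
    also have "btw E C (V - C) = btw E C {v}" using comps_attached(2)[OF finV connV _ _ C] v by simp
    finally show ?thesis .
  qed
  have "tau E V \<le> 1 + tau E (V - {v})" using tau_delete[of V "{v}" E] finV v by simp
  then have "2 + 1 + btw E {v} (V - {v}) - 7 \<le> (\<Sum>C\<in>comps E (V - {v}). exc E C)"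
    using sum_exc_comps_ge[of "{v}" 1] v wt_singleton by simp
  also have "\<dots> \<le> (\<Sum>C\<in>comps E (V - {v}). btw E C {v} - 3)" by (rule sum_mono) (rule ex)
  also have "\<dots> = btw E {v} (V - {v}) - 3 * int (card (comps E (V - {v})))"
    using btw_sum_comps[of "V - {v}" "{v}" E] finV by (simp add: sum_subtractf btw_commute)
  finally have "card (comps E (V - {v})) \<le> Suc 0" by linarith
  then have eq: "C = D" if "C \<in> comps E (V - {v})" "D \<in> comps E (V - {v})" for C D
    using that finite_comps[of "V - {v}" E] finV by (auto simp: card_le_Suc0_iff_eq)
  obtain a where "(a, v) \<in> E" using in_nonempty[OF v] .
  then have "a \<in> V - {v}" using inV irrefl by blast
  then obtain C where C: "C \<in> comps E (V - {v})" using comps_cover[of "V - {v}" a E] finV by blast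
  have "V - {v} \<subseteq> C"
  proof
    fix x assume x: "x \<in> V - {v}"
    then obtain D where "D \<in> comps E (V - {v})" "x \<in> D" using comps_cover[of "V - {v}" x E] finV by blast
    then show "x \<in> C" using eq[OF C] by blast
  qed
  then have "C = V - {v}" using compsD(1)[OF C] by blast
  then show False using compsD(2)[OF C] neg by simp
qed

lemma deg_le_5: assumes v: "v \<in> V" shows "deg E v \<le> 5"
proof -
  have "tau E V \<le> 1 + tau E (V - {v})" using tau_delete[of V "{v}" E] finV v by simp
  then have "2 + 1 + btw E {v} (V - {v}) - 7 \<le> (\<Sum>C\<in>comps E (V - {v}). exc E C)"
    using sum_exc_comps_ge[of "{v}" 1] v wt_singleton by simp
  also have "\<dots> = exc E (V - {v})" using comps_conn[OF conn_delete[OF v]] by simp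
  also have "\<dots> \<le> 1" by (rule exc_sub) (use v conn_delete in auto)
  finally show ?thesis using btw_singleton[OF v] by simp
qed

section \<open>Counting extremal components after a deletion\<close>

definition bad :: "'a set \<Rightarrow> 'a set set" where
  "bad Y = {C \<in> comps E (V - Y). 1 \<le> exc E C}"

text \<open>A nonnegative balance yields at least two bad components. A vertex of a second one,
  added to \<open>Y\<close>, supplies the three outside vertices that \<open>exc_attached\<close>
  asks for.\<close>

lemma bad_comps:
  assumes Y: "Y \<subseteq> V" "2 \<le> card Y" and k: "tau E V \<le> k + tau E (V - Y)"
    and s: "7 * int k \<le> wt E Y + btw E Y (V - Y)"
  shows "2 + wt E Y + btw E Y (V - Y) - 7 * int k \<le> int (card (bad Y))"
    and "C \<in> bad Y \<Longrightarrow> exc E C = 1" and "C \<in> bad Y \<Longrightarrow> 4 \<le> btw E C Y"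
proof -
  have Y0: "Y \<noteq> {}" using Y(2) by auto
  have fc: "finite (comps E (V - Y))" using finV finite_comps by blast
  then have fb: "finite (bad Y)" by (simp add: bad_def)
  have "(\<Sum>C\<in>comps E (V - Y). exc E C) \<le> (\<Sum>C\<in>comps E (V - Y). if C \<in> bad Y then 1 else 0)"
    by (rule sum_mono) (use exc_comp[OF Y(1) Y0] in \<open>auto simp: bad_def\<close>)
  also have "\<dots> = int (card (comps E (V - Y) \<inter> bad Y))"
    using fc by (simp add: sum.If_cases)
  also have "comps E (V - Y) \<inter> bad Y = bad Y" by (auto simp: bad_def)
  finally show 1: "2 + wt E Y + btw E Y (V - Y) - 7 * int k \<le> int (card (bad Y))"
    using sum_exc_comps_ge[OF Y(1) k] by linarith
  assume C: "C \<in> bad Y"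
  then have Cc: "C \<in> comps E (V - Y)" by (simp add: bad_def)
  show "exc E C = 1" using C exc_comp[OF Y(1) Y0 Cc] by (simp add: bad_def)
  have "card (bad Y) \<ge> 2" using 1 s by linarith
  then have "bad Y \<noteq> {C}" by auto
  then obtain D where D: "D \<in> bad Y" "D \<noteq> C" using C by blast
  then have Dc: "D \<in> comps E (V - Y)" by (simp add: bad_def)
  obtain d where d: "d \<in> D" using compsD(2)[OF Dc] by (auto simp: conn_def)
  have dn: "d \<in> V" "d \<notin> Y" "d \<notin> C"
    using d compsD(1)[OF Dc] comps_disjoint[OF Dc Cc D(2)] by auto
  have "card (insert d Y) \<le> card (V - C)"
    by (rule card_mono) (use finV Y(1) dn compsD(1)[OF Cc] in auto)
  then have "3 \<le> card (V - C)" using dn Y fin[OF Y(1)] by simp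
  then have "exc E C \<le> btw E C (V - C) - 3"
    by (intro exc_attached) (use compsD(1,2)[OF Cc] in auto)
  then show "4 \<le> btw E C Y"
    using comps_attached(2)[OF finV connV Y(1) Y0 Cc] C by (simp add: bad_def)
qed

lemma sum_bad_le:
  assumes "Y \<subseteq> V"
  shows "(\<Sum>C\<in>bad Y. btw E C Y) \<le> btw E Y (V - Y)"
proof -
  have "(\<Sum>C\<in>bad Y. btw E C Y) \<le> (\<Sum>C\<in>comps E (V - Y). btw E C Y)"
    by (rule sum_mono2) (use finite_comps[of "V - Y" E] finV btw_nonneg in \<open>auto simp: bad_def\<close>)
  then show ?thesis using btw_sum_comps[of "V - Y" Y E] finV fin[OF assms] by (simp add: btw_commute)
qed

text \<open>With balance s there are at least s + 2 bad components with four boundary arcs each, so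
  \<open>btw E Y (V - Y)\<close> would be at least 4 s + 8.\<close>

lemma delete_absurd_btw:
  assumes Y: "Y \<subseteq> V" "2 \<le> card Y" and k: "tau E V \<le> k + tau E (V - Y)"
    and s: "7 * int k \<le> wt E Y + btw E Y (V - Y)"
    and L: "btw E Y (V - Y) \<le> 4 * (wt E Y + btw E Y (V - Y) - 7 * int k) + 7"
  shows False
proof -
  have "(\<Sum>C\<in>bad Y. 4) \<le> (\<Sum>C\<in>bad Y. btw E C Y)"
    by (rule sum_mono) (rule bad_comps(3)[OF Y k s])
  then have le: "4 * int (card (bad Y)) \<le> btw E Y (V - Y)" using sum_bad_le[OF Y(1)] by simp
  have "False" if "4 * B \<le> b" "2 + w + b - 7 * K \<le> B" "b \<le> 4 * (w + b - 7 * K) + 7" for B b w K :: int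
    using that by presburger
  from this[OF le bad_comps(1)[OF Y k s] L] show False .
qed

lemma wt_btw_deg:
  assumes "Y \<subseteq> V"
  shows "btw E Y (V - Y) = (\<Sum>y\<in>Y. int (deg E y)) - 2 * int (card (ind E Y))"
    and "wt E Y = int (card Y) + int (card (ind E Y))"
  using handshake[OF finV EV assms] by (simp_all add: wt_def)

text \<open>The same test, rewritten with \<open>btw\<close> as the degree sum minus twice the inner
  arcs and \<open>wt\<close> as vertices plus inner arcs.\<close>

lemma delete_absurd_sum:
  assumes Y: "Y \<subseteq> V" "2 \<le> card Y" and k: "tau E V \<le> k + tau E (V - Y)"
    and "card (ind E Y) + 7 * k \<le> card Y + (\<Sum>y\<in>Y. deg E y)"
    and "28 * k + 2 * card (ind E Y) \<le> 4 * card Y + 3 * (\<Sum>y\<in>Y. deg E y) + 7"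
  shows False
  by (rule delete_absurd_btw[OF Y k]) (use assms(4,5) wt_btw_deg[OF Y(1)] in \<open>simp_all flip: of_nat_sum\<close>)

end

subsection \<open>Contracting an arc, small degrees\<close>

text \<open>Every cycle in \<open>W\<close> through \<open>w\<close> passes through
  \<open>a\<close>, so contracting the arc \<open>(a, w)\<close> does not lower the feedback number.
  The vertex \<open>w\<close> and the arc \<open>(a, w)\<close> disappear, which accounts for the
  gain of 2.\<close>

lemma exc_contract:
  assumes fin: "finite W" and w: "w \<in> W" "(w, w) \<notin> E" and a: "E\<inverse> `` {w} \<inter> W = {a}"
  shows "exc E W + 2 \<le> exc (E \<union> {a} \<times> (E `` {w} \<inter> W)) (W - {w})"
proof -
  define E' where "E' = E \<union> {a} \<times> (E `` {w} \<inter> W)"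
  have aw: "a \<in> W" "a \<noteq> w" "(a, w) \<in> E" using a w by auto
  have only: "x = a" if "(x, w) \<in> E" "x \<in> W" for x using that a by auto
  have "tau E W \<le> tau E' (W - {w})"
  proof -
    obtain S where S: "S \<subseteq> W - {w}" "acyc E' (W - {w} - S)" "card S = tau E' (W - {w})" by (rule tau_attained)
    obtain f :: "'a \<Rightarrow> nat" where
      f: "\<And>x y. x \<in> W - {w} - S \<Longrightarrow> y \<in> W - {w} - S \<Longrightarrow> (x, y) \<in> E' \<Longrightarrow> f x < f y"
      using acycE[OF S(2)] by blast
    have "acyc E (W - S)"
    proof (cases "a \<in> S")
      case True
      have "acyc E ({w} \<union> (W - {w} - S))"
      proof (rule acyc_Un_oneway)
        show "acyc E {w}" using w by (auto simp: acyc_def)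
        show "acyc E (W - {w} - S)" by (rule acyc_subset[OF S(2)]) (auto simp: E'_def)
        show "(y, x) \<notin> E" if "x \<in> {w}" "y \<in> W - {w} - S" for x y
          using that only True by auto
      qed (use fin in auto)
      moreover have "W - S = {w} \<union> (W - {w} - S)" using w S(1) by auto
      ultimately show ?thesis by simp
    next
      case False
      show ?thesis
      proof (rule acycI)
        fix x y assume xy: "x \<in> W - S" "y \<in> W - S" "(x, y) \<in> E"
        \<comment> \<open>Doubling the ranks frees the odd value just above that of \<open>a\<close>
          for \<open>w\<close>.\<close>
        show "(if x = w then 2 * f a + 1 else 2 * f x) < (if y = w then 2 * f a + 1 else 2 * f y)"
        proof (cases "x = w")
          case True
          then have "(a, y) \<in> E'" "y \<noteq> w" using xy w by (auto simp: E'_def)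
          then have "f a < f y" using xy aw False by (intro f) auto
          then show ?thesis using True \<open>y \<noteq> w\<close> by simp
        next
          case xw: False
          show ?thesis
          proof (cases "y = w")
            case True
            then show ?thesis using only[of x] xy xw by auto
          next
            case yw: False
            then have "f x < f y" using xy xw by (intro f) (auto simp: E'_def)
            then show ?thesis using xw yw by simp
          qed
        qed
      qed
    qed
    then show ?thesis using tau_le[of S W E] S by auto
  qed
  moreover have "wt E' (W - {w}) + 2 \<le> wt E W"
  proof -
    have "card (ind E' (W - {w})) \<le> card (ind E (W - {w}) \<union> {a} \<times> (E `` {w} \<inter> W))"
      by (rule card_mono) (use fin in \<open>auto simp: E'_def ind_def\<close>)
    also have "\<dots> \<le> card (ind E (W - {w})) + card (E `` {w} \<inter> W)"
      using card_Un_le[of "ind E (W - {w})" "{a} \<times> (E `` {w} \<inter> W)"] by (simp add: card_cartesian_product)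
    finally have 1: "card (ind E' (W - {w})) \<le> card (ind E (W - {w})) + card (E `` {w} \<inter> W)" .
    have "E `` {w} \<inter> W = snd ` (E \<inter> {w} \<times> (W - {w}))" using w by force
    then have 2: "card (E `` {w} \<inter> W) \<le> card (E \<inter> {w} \<times> (W - {w}))"
      using fin by (auto intro: card_image_le)
    have "card {(a, w)} \<le> card (E \<inter> (W - {w}) \<times> {w})"
      by (rule card_mono) (use fin aw in auto)
    then have "int (card (E `` {w} \<inter> W)) + 1 \<le> btw E {w} (W - {w})" using 2 by (simp add: btw_def)
    moreover have "wt E W = wt E {w} + wt E (W - {w}) + btw E {w} (W - {w})"
      using wt_split[OF fin, of "{w}" E] w by simp
    moreover have "wt E {w} \<ge> 1" by (simp add: wt_def)
    ultimately show ?thesis using 1 by (simp add: wt_def)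
  qed
  ultimately show ?thesis unfolding E'_def[symmetric] by (simp add: exc_def)
qed

lemma conn_contract:
  assumes W: "conn E W" and w: "w \<in> W" and a: "E\<inverse> `` {w} \<inter> W = {a}" "a \<noteq> w"
  shows "conn (E \<union> {a} \<times> (E `` {w} \<inter> W)) (W - {w})"
proof -
  define E' where "E' = E \<union> {a} \<times> (E `` {w} \<inter> W)"
  have aW: "a \<in> W" using a by auto
  have only: "x = a" if "(x, w) \<in> E" "x \<in> W" for x using that a by auto
  have E1: "(x, y) \<in> E'" if "(x, y) \<in> E" for x y using that by (simp add: E'_def)
  have E2: "(a, y) \<in> E'" if "(w, y) \<in> E" "y \<in> W" for y using that by (simp add: E'_def)
  have "\<exists>x\<in>X. \<exists>y\<in>W - {w} - X. (x, y) \<in> E' \<or> (y, x) \<in> E'"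
    if X: "X \<subseteq> W - {w}" "X \<noteq> {}" "X \<noteq> W - {w}" for X
  proof (cases "a \<in> X")
    case True
    have "insert w X \<subseteq> W" "insert w X \<noteq> {}" "insert w X \<noteq> W" using X w by auto
    then obtain x y where xy: "x \<in> insert w X" "y \<in> W" "y \<notin> insert w X" "(x, y) \<in> E \<or> (y, x) \<in> E"
      using connD[OF W] by blast
    show ?thesis
    proof (cases "x = w")
      case True
      then have "(w, y) \<in> E" using xy only[of y] \<open>a \<in> X\<close> by auto
      then show ?thesis using E2[of y] xy \<open>a \<in> X\<close> by blast
    next
      case False
      then show ?thesis using E1 xy by blast
    qed
  next
    case False
    have "X \<subseteq> W" "X \<noteq> W" using X w by auto
    then obtain x y where xy: "x \<in> X" "y \<in> W" "y \<notin> X" "(x, y) \<in> E \<or> (y, x) \<in> E"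
      using connD[OF W, of X] X(2) by blast
    show ?thesis
    proof (cases "y = w")
      case True
      then have "(w, x) \<in> E" using xy only[of x] False X by auto
      then have "(a, x) \<in> E'" using E2 xy X by auto
      then show ?thesis using xy False aW a(2) by blast
    next
      case False
      then show ?thesis using E1 xy by blast
    qed
  qed
  moreover have "W - {w} \<noteq> {}" using aW a(2) by blast
  ultimately show ?thesis unfolding conn_def E'_def[symmetric] by blast
qed

context mincex begin

text \<open>The contracted graph would have \<open>exc\<close> at least 2 on fewer vertices.
  Minimality forbids this unless contraction creates a digon, and a digon comes from a directed
  triangle through \<open>(a, w)\<close>.\<close>

lemma contract_arc:
  assumes W: "W \<subseteq> V" "conn E W" and w: "w \<in> W" and a: "E\<inverse> `` {w} \<inter> W = {a}"
    and exc: "0 \<le> exc E W"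
  obtains x where "x \<in> W" "(w, x) \<in> E" "(x, a) \<in> E"
proof -
  have False if no: "\<And>x. x \<in> W \<Longrightarrow> (w, x) \<in> E \<Longrightarrow> (x, a) \<notin> E"
  proof -
    let ?E' = "E \<union> {a} \<times> (E `` {w} \<inter> W)"
    have aw: "(a, w) \<in> E" using a by auto
    have "exc ?E' (W - {w}) \<le> 1"
    proof (rule small)
      have "card (W - {w}) < card W" by (rule psubset_card_mono) (use w fin[OF W(1)] in auto)
      then show "card (W - {w}) < card V" using card_mono[OF finV W(1)] by simp
      show "conn ?E' (W - {w})" by (rule conn_contract[OF W(2) w(1) a]) (use aw irrefl in auto)
      show "(y, x) \<notin> ?E'" if "(x, y) \<in> ?E'" for x y
        using that no[of x] no[of y] asym[of x y] asym[of a w] aw irrefl by auto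
    qed (use fin[OF W(1)] in auto)
    moreover have "exc E W + 2 \<le> exc ?E' (W - {w})"
      by (rule exc_contract[OF fin[OF W(1)] w irrefl a])
    ultimately show False using exc by linarith
  qed
  then show ?thesis using that by blast
qed

lemma tau_delete_set: "K \<subseteq> V \<Longrightarrow> tau E V \<le> card K + tau E (V - K)"
  using tau_delete finV by blast

text \<open>A vertex whose in-neighbours, or whose out-neighbours, are all gone has become a source
  or a sink and leaves at no cost. Iterating this builds the sets \<open>Y\<close> used for
  counting.\<close>

lemma tau_delete_free:
  assumes "tau E V \<le> k + tau E (V - Z)" "E\<inverse> `` {u} \<subseteq> Z \<or> E `` {u} \<subseteq> Z"
  shows "tau E V \<le> k + tau E (V - insert u Z)"
proof -
  have "tau E (V - Z) \<le> tau E (V - Z - {u})"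
    using assms(2)
  proof
    assume "E\<inverse> `` {u} \<subseteq> Z"
    then show ?thesis by (intro tau_source) (use finV in auto)
  next
    assume "E `` {u} \<subseteq> Z"
    then show ?thesis by (intro tau_sink) (use finV in auto)
  qed
  moreover have "V - Z - {u} = V - insert u Z" by auto
  ultimately show ?thesis using assms(1) by simp
qed

lemma delete_absurd:
  assumes "Y \<subseteq> V" "card Y = n" "2 \<le> n" "tau E V \<le> k + tau E (V - Y)"
    "(\<Sum>y\<in>Y. deg E y) = d" "card (ind E Y) \<le> e"
    "e + 7 * k \<le> n + d" "28 * k + 2 * e \<le> 4 * n + 3 * d + 7"
  shows False
  by (rule delete_absurd_sum[OF assms(1) _ assms(4)]) (use assms in linarith)+

lemma deg_pos: assumes "v \<in> V" shows "1 \<le> card (E `` {v})" "1 \<le> card (E\<inverse> `` {v})"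
proof -
  obtain x y where "(x, v) \<in> E" "(v, y) \<in> E" using in_nonempty[OF assms] out_nonempty[OF assms] by metis
  then have "E `` {v} \<noteq> {}" "E\<inverse> `` {v} \<noteq> {}" by auto
  then show "1 \<le> card (E `` {v})" "1 \<le> card (E\<inverse> `` {v})"
    using fin_nbrs by (simp_all add: Suc_le_eq card_gt_0_iff)
qed

text \<open>A single in-neighbour \<open>a\<close> forces a directed triangle \<open>a\<close>,
  \<open>w\<close>, \<open>x\<close>. The pair \<open>{w, a}\<close> goes at cost 1, which bounds
  its degree sum by 5. Then deleting \<open>x\<close> alone frees the other two, but a triangle has
  weight at least 6, while cost 1 allows only 5.\<close>

lemma indeg_ge_2: assumes w: "w \<in> V" shows "2 \<le> card (E\<inverse> `` {w})"
proof (rule ccontr)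
  assume "\<not> ?thesis"
  then have "card (E\<inverse> `` {w}) = 1" using deg_pos(2)[OF w] by linarith
  then obtain a where a: "E\<inverse> `` {w} = {a}" by (rule card_1_singletonE)
  have aw: "(a, w) \<in> E" using a by auto
  have aV: "a \<in> V" using inV aw by blast
  have "E\<inverse> `` {w} \<inter> V = {a}" using a aV by auto
  then obtain x where x: "x \<in> V" "(w, x) \<in> E" "(x, a) \<in> E"
    using contract_arc[of V w a] connV w excV by auto
  have ne: "a \<noteq> w" "x \<noteq> a" "x \<noteq> w" using aw x irrefl asym by auto
  have "tau E V \<le> 1 + tau E (V - insert w {a})"
    using tau_delete_free[of "card {a}" "{a}" w] tau_delete_set[of "{a}"] aV a by simp
  then have k: "tau E V \<le> 1 + tau E (V - {w, a})" .
  have "ind E {w, a} = {(a, w)}" using aw asym[OF aw] irrefl[of w] irrefl[of a] unfolding ind_def by blast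
  then have e: "card (ind E {w, a}) \<le> 1" by simp
  have D: "deg E w + deg E a \<le> 5"
  proof (rule ccontr)
    assume "\<not> ?thesis"
    then show False
      using delete_absurd[OF _ _ _ k _ e, of 2 "deg E w + deg E a"] ne(1) w aV by simp
  qed
  have inw: "x \<in> E `` {w}" "w \<in> E `` {a}" "x \<in> E\<inverse> `` {a}" using x aw by auto
  have "tau E V \<le> 1 + tau E (V - {w, a, x})"
  proof (cases "deg E a = 2")
    case True
    then have "card (E\<inverse> `` {a}) = 1" using deg_pos[OF aV] by (simp add: deg_def)
    then have "E\<inverse> `` {a} = {x}" using inw(3) by (metis card_1_singletonE singletonD)
    then have "tau E V \<le> 1 + tau E (V - insert a {x})"
      using tau_delete_free[of "card {x}" "{x}" a] tau_delete_set[of "{x}"] x by simp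
    then have "tau E V \<le> 1 + tau E (V - insert w (insert a {x}))"
      by (rule tau_delete_free) (use a in auto)
    then show ?thesis by simp
  next
    case False
    then have "deg E w = 2" "deg E a = 3"
      using D deg_pos[OF aV] deg_pos[OF w] by (auto simp: deg_def)
    then have "card (E `` {w}) = 1" using a by (simp add: deg_def)
    then have "E `` {w} = {x}" using inw(1) by (metis card_1_singletonE singletonD)
    then have 1: "tau E V \<le> 1 + tau E (V - insert w {x})"
      using tau_delete_free[of "card {x}" "{x}" w] tau_delete_set[of "{x}"] x by simp
    have "card (E `` {a}) = 1 \<or> card (E\<inverse> `` {a}) = 1"
      using \<open>deg E a = 3\<close> deg_pos[OF aV] by (auto simp: deg_def)
    then have "E `` {a} = {w} \<or> E\<inverse> `` {a} = {x}" using inw(2,3) by (metis card_1_singletonE singletonD)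
    then have "tau E V \<le> 1 + tau E (V - insert a (insert w {x}))"
      by (intro tau_delete_free[OF 1]) auto
    then show ?thesis by (simp add: insert_commute)
  qed
  then have "wt E {w, a, x} + 2 \<le> 7 * int 1" by (intro wt_le_of_delete) (use w aV x in auto)
  moreover have "card {(a, w), (w, x), (x, a)} \<le> card (ind E {w, a, x})"
    by (rule card_mono) (use aw x in \<open>auto simp: ind_def\<close>)
  ultimately show False using ne by (simp add: wt_def)
qed

lemma outdeg_ge_2: assumes "w \<in> V" shows "2 \<le> card (E `` {w})"
proof -
  interpret d: mincex "E\<inverse>" V by (rule dual)
  show ?thesis using d.indeg_ge_2[OF assms] by simp
qed

lemma deg_ge_4: "v \<in> V \<Longrightarrow> 4 \<le> deg E v"
  using indeg_ge_2[of v] outdeg_ge_2[of v] by (simp add: deg_def)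

text \<open>Once \<open>v\<close> is deleted, \<open>y\<close> has the single in-neighbour
  \<open>z\<close>. Since \<open>deg E v\<close> is at least 4, \<open>exc\<close> of the connected
  rest is at least 2 - 7 + 1 + 4 = 0, so the arc \<open>(z, y)\<close> can be tested by
  contraction.\<close>

lemma in_triangle:
  assumes y: "E\<inverse> `` {y} = {v, z}" "v \<noteq> z"
  obtains x where "(y, x) \<in> E" "(x, z) \<in> E"
proof -
  have arcs: "(v, y) \<in> E" "(z, y) \<in> E" using y by auto
  then have vV: "v \<in> V" "y \<in> V" "z \<in> V" and ne: "y \<noteq> v" "y \<noteq> z" using inV irrefl by auto
  let ?W = "V - {v}"
  have *: "tau E V \<le> 1 + tau E ?W" using tau_delete_set[of "{v}"] vV by simp
  have "wt E V = 1 + wt E ?W + int (deg E v)"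
    using wt_split[OF finV, of "{v}" E] wt_singleton[of v] btw_singleton[of v] vV by simp
  then have exc: "0 \<le> exc E ?W" using * excV deg_ge_4[OF vV(1)] by (simp add: exc_def)
  have in1: "E\<inverse> `` {y} \<inter> ?W = {z}" using y vV by auto
  show ?thesis
    using contract_arc[of ?W y z] conn_delete[OF vV(1)] in1 exc vV ne that by auto
qed

end

subsection \<open>All degrees are four\<close>

lemma acyc_Un_bridge:
  assumes fin: "finite A" "finite B" and "acyc E A" "acyc E B" and "btw E A B \<le> 1"
  shows "acyc E (A \<union> B)"
proof -
  have "card (E \<inter> A \<times> B) = 0 \<or> card (E \<inter> B \<times> A) = 0" using assms(5) by (auto simp: btw_def)
  then have "E \<inter> A \<times> B = {} \<or> E \<inter> B \<times> A = {}" using fin by auto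
  then show ?thesis
  proof
    assume "E \<inter> B \<times> A = {}"
    then show ?thesis by (intro acyc_Un_oneway[OF fin assms(3,4)]) blast
  next
    assume "E \<inter> A \<times> B = {}"
    then have "acyc E (B \<union> A)" by (intro acyc_Un_oneway[OF fin(2,1) assms(4,3)]) blast
    then show ?thesis by (simp add: Un_commute)
  qed
qed

context mincex begin

lemma deg_cases: "v \<in> V \<Longrightarrow> deg E v = 4 \<or> deg E v = 5"
  using deg_ge_4[of v] deg_le_5[of v] by linarith

lemma deg_4D:
  assumes "v \<in> V" "deg E v = 4"
  shows "card (E `` {v}) = 2" "card (E\<inverse> `` {v}) = 2"
  using assms indeg_ge_2[of v] outdeg_ge_2[of v] by (auto simp: deg_def)

text \<open>In the worst case \<open>Y\<close> is a tournament with all degrees 4; the balance is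
  then exactly 0 and the test still succeeds.\<close>

lemma delete_four_absurd:
  assumes Y: "Y \<subseteq> V" "card Y = 4" and k: "tau E V \<le> 2 + tau E (V - Y)"
  shows False
proof (rule delete_absurd[OF Y _ k refl])
  have "(\<Sum>y\<in>Y. 4) \<le> (\<Sum>y\<in>Y. deg E y)" by (rule sum_mono) (use Y deg_ge_4 in auto)
  then have d: "16 \<le> (\<Sum>y\<in>Y. deg E y)" using Y by simp
  show "card (ind E Y) \<le> 6" using card_ind_le[OF fin[OF Y(1)] asym] Y(2) by simp
  show "6 + 7 * 2 \<le> 4 + (\<Sum>y\<in>Y. deg E y)" using d by simp
  show "28 * 2 + 2 * 6 \<le> 4 * 4 + 3 * (\<Sum>y\<in>Y. deg E y) + 7" using d by simp
qed simp

lemma btw_single: "btw E {x} {y} = (if (x, y) \<in> E \<or> (y, x) \<in> E then 1 else 0)"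
proof -
  have "E \<inter> {x} \<times> {y} = (if (x, y) \<in> E then {(x, y)} else {})"
    "E \<inter> {y} \<times> {x} = (if (y, x) \<in> E then {(y, x)} else {})" by auto
  then show ?thesis using asym[of x y] by (simp add: btw_def)
qed

section \<open>Deletions that leave exactly two extremal components, and gluing across them\<close>

definition two_split :: "'a set \<Rightarrow> 'a set \<Rightarrow> 'a set \<Rightarrow> bool" where
  "two_split Y C D \<longleftrightarrow> Y \<subseteq> V \<and> conn E C \<and> conn E D \<and> C \<inter> D = {} \<and> C \<union> D = V - Y \<and>
     btw E C D = 0 \<and> exc E C = 1 \<and> exc E D = 1 \<and> wt E V = wt E C + wt E D + 14"

text \<open>Balance 0 forces two bad components, and nine boundary arcs leave no room for a third.
  Any other component would get at most one arc, hence have \<open>exc\<close> at most -2, too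
  little for a total of at least 2.\<close>

lemma two_splitI:
  assumes Y: "Y \<subseteq> V" "card Y = 3" and k: "tau E V \<le> 2 + tau E (V - Y)"
    and s: "wt E Y + btw E Y (V - Y) = 14" and L: "btw E Y (V - Y) \<le> 9"
  obtains C D where "two_split Y C D" "4 \<le> btw E C Y" "4 \<le> btw E D Y"
    "btw E C Y + btw E D Y = btw E Y (V - Y)"
proof -
  have Y2: "2 \<le> card Y" and s': "7 * int 2 \<le> wt E Y + btw E Y (V - Y)" using Y(2) s by simp_all
  have Y0: "Y \<noteq> {}" using Y(2) by auto
  note bc = bad_comps[OF Y(1) Y2 k s']
  have fc: "finite (comps E (V - Y))" using finV finite_comps by blast
  have sub: "bad Y \<subseteq> comps E (V - Y)" by (auto simp: bad_def)
  have fb: "finite (bad Y)" using sub fc by (rule finite_subset)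
  have "(\<Sum>C\<in>bad Y. 4) \<le> (\<Sum>C\<in>bad Y. btw E C Y)" by (rule sum_mono) (rule bc(3))
  then have b4: "4 * int (card (bad Y)) \<le> (\<Sum>C\<in>bad Y. btw E C Y)" by simp
  have "2 \<le> int (card (bad Y))" using bc(1) s by simp
  moreover have "4 * int (card (bad Y)) \<le> 9" using b4 sum_bad_le[OF Y(1)] L by linarith
  ultimately have b2: "card (bad Y) = 2" by linarith
  then obtain C D where CD: "bad Y = {C, D}" "C \<noteq> D" by (auto simp: card_2_iff)
  define R where "R = comps E (V - Y) - bad Y"
  have sumR: "(\<Sum>C\<in>comps E (V - Y). f C) = (\<Sum>C\<in>R. f C) + (f C + f D)" for f :: "'a set \<Rightarrow> int"
    using sum.subset_diff[OF sub fc, of f] CD by (simp add: R_def)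
  have tot: "(\<Sum>C\<in>comps E (V - Y). btw E C Y) = btw E Y (V - Y)"
    using btw_sum_comps[of "V - Y" Y E] finV fin[OF Y(1)] by (simp add: btw_commute)
  have q: "4 \<le> btw E C Y" "4 \<le> btw E D Y" using bc(3) CD by auto
  have e: "exc E C = 1" "exc E D = 1" using bc(2) CD by auto
  have R1: "exc E K \<le> -2" if K: "K \<in> R" for K
  proof -
    have Kc: "K \<in> comps E (V - Y)" using K by (simp add: R_def)
    have fR: "finite R" using fc by (simp add: R_def)
    have "btw E K Y \<le> (\<Sum>C\<in>R. btw E C Y)"
      by (rule member_le_sum[OF K _ fR]) (rule btw_nonneg)
    then have "btw E K Y \<le> 1" using sumR[of "\<lambda>C. btw E C Y"] tot q L by linarith
    moreover have "card Y \<le> card (V - K)"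
      by (rule card_mono) (use finV Y(1) compsD(1)[OF Kc] in auto)
    then have "exc E K \<le> btw E K (V - K) - 3"
      by (intro exc_attached) (use compsD(1,2)[OF Kc] Y(2) in auto)
    ultimately show ?thesis using comps_attached(2)[OF finV connV Y(1) Y0 Kc] by linarith
  qed
  have "R = {}"
  proof (rule ccontr)
    assume "R \<noteq> {}"
    moreover have fR: "finite R" using fc by (simp add: R_def)
    ultimately have "card R > 0" by (simp add: card_gt_0_iff)
    moreover have "(\<Sum>C\<in>R. exc E C) \<le> (\<Sum>C\<in>R. -2)" by (rule sum_mono) (rule R1)
    ultimately have "(\<Sum>C\<in>R. exc E C) < 0" by simp
    then show False using sumR[of "exc E"] e sum_exc_comps_ge[OF Y(1) k] s by simp
  qed
  then have comps: "comps E (V - Y) = {C, D}" using CD sub by (auto simp: R_def)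
  have Cc: "C \<in> comps E (V - Y)" and Dc: "D \<in> comps E (V - Y)" using comps by auto
  have UN: "C \<union> D = V - Y"
  proof
    show "C \<union> D \<subseteq> V - Y" using compsD(1)[OF Cc] compsD(1)[OF Dc] by blast
    show "V - Y \<subseteq> C \<union> D"
    proof
      fix x assume "x \<in> V - Y"
      then obtain K where "K \<in> comps E (V - Y)" "x \<in> K" using comps_cover[of "V - Y" x E] finV by blast
      then show "x \<in> C \<union> D" using comps by auto
    qed
  qed
  have disj: "C \<inter> D = {}" by (rule comps_disjoint[OF Cc Dc CD(2)])
  have b0: "btw E C D = 0"
    by (rule btw_0) (use compsD(3)[OF Cc] compsD(1)[OF Dc] disj in blast)
  have "wt E (C \<union> D) = wt E C + wt E D"
    using wt_Un[of C D E] disj b0 UN finV by (metis Un_upper1 Un_upper2 add.right_neutral finite_Diff finite_subset)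
  then have "wt E V = wt E C + wt E D + 14"
    using wt_split[OF finV Y(1), of E] UN s by simp
  then have "two_split Y C D"
    using Y(1) compsD(2)[OF Cc] compsD(2)[OF Dc] disj UN b0 e by (simp add: two_split_def)
  moreover have "btw E C Y + btw E D Y = btw E Y (V - Y)"
    using sumR[of "\<lambda>C. btw E C Y"] tot \<open>R = {}\<close> by simp
  ultimately show ?thesis using that q by blast
qed

text \<open>An extremal component has so much slack that a small acyclic set can be added without raising its feedback
  number; an optimal set of the union then lies inside the component.\<close>

lemma extend_fvs:
  assumes C: "conn E C" "exc E C = 1" and Z: "conn E Z" "acyc E Z" "wt E Z + btw E C Z \<le> 6"
    and CZ: "C \<inter> Z = {}" "C \<union> Z \<subseteq> V" "C \<union> Z \<noteq> V"
  obtains S where "S \<subseteq> C" "card S = tau E C" "acyc E (C \<union> Z - S)"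
proof (cases "btw E C Z = 0")
  case True
  obtain S where S: "S \<subseteq> C" "acyc E (C - S)" "card S = tau E C" by (rule tau_attained)
  have f: "finite C" "finite Z" using CZ(2) fin by auto
  have "btw E (C - S) Z = 0"
    by (rule btw_0) (use btw_eq_0D[OF f] True in auto)
  then have "acyc E ((C - S) \<union> Z)" by (intro acyc_Un_bridge) (use f S Z in auto)
  moreover have "C \<union> Z - S = (C - S) \<union> Z" using S(1) CZ(1) by blast
  ultimately show ?thesis using that S by simp
next
  case False
  have f: "finite C" "finite Z" using CZ(2) fin by auto
  have "\<exists>x\<in>C. \<exists>y\<in>Z. (x, y) \<in> E \<or> (y, x) \<in> E"
    using False btw_0[of C Z E] by blast
  then have "conn E (C \<union> Z)" by (intro conn_Un C(1) Z(1)) blast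
  then have "exc E (C \<union> Z) \<le> 1" by (intro exc_sub) (use CZ in auto)
  \<comment> \<open>\<open>7 * tau E (C \<union> Z)\<close> is at most
    \<open>wt E C + 6 + 1 = 7 * tau E C + 6\<close>, and 6 is less than one deletion.\<close>
  then have le: "tau E (C \<union> Z) \<le> tau E C"
    using wt_Un[OF f CZ(1), of E] C(2) Z(3) by (simp add: exc_def)
  obtain S where S: "S \<subseteq> C \<union> Z" "acyc E (C \<union> Z - S)" "card S = tau E (C \<union> Z)" by (rule tau_attained)
  have fS: "finite S" using S(1) f by (meson finite_Un finite_subset)
  have "acyc E (C - S \<inter> C)" by (rule acyc_mono[OF S(2)]) auto
  then have t: "tau E C \<le> card (S \<inter> C)" by (intro tau_le) auto
  then have "card S \<le> card (S \<inter> C)" using le S(3) by simp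
  then have "S \<inter> C = S" using fS by (intro card_seteq) auto
  then have "S \<subseteq> C" "card S = tau E C" using t le S(3) by auto
  then show ?thesis using that S(2) by blast
qed

text \<open>The removed weight 14 is that of exactly two deletions: 7 tau(V) \<ge> wt(V) + 2 = wt(C)
  + wt(D) + 16 = 7 tau(C) + 7 tau(D) + 14. So saving one of the two deletions is a contradiction, at
  which both gluing lemmas aim.\<close>

lemma two_split_tau:
  assumes "two_split Y C D"
  shows "\<not> tau E V \<le> 1 + tau E C + tau E D"
  using assms excV by (auto simp: two_split_def exc_def)

text \<open>Only \<open>y\<close> is deleted. The arc on \<open>w\<close>, \<open>w'\<close> has
  weight 3, so three further arcs stay within the limit 6 of \<open>extend_fvs\<close> on each side;
  both acyclic sides contain the arc and are glued along it.\<close>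

lemma no_pair_glue:
  assumes sp: "two_split {y, w, w'} C D" and ne: "y \<noteq> w" "y \<noteq> w'" and ww: "(w, w') \<in> E"
    and q: "btw E C {w} + btw E C {w'} \<le> 3" "btw E D {w} + btw E D {w'} \<le> 3"
  shows False
proof -
  have wne: "w \<noteq> w'" using ww irrefl by auto
  have YV: "{y, w, w'} \<subseteq> V" and CDV: "C \<inter> D = {}" "C \<union> D = V - {y, w, w'}"
    and CD: "conn E C" "conn E D" "exc E C = 1" "exc E D = 1" and b0: "btw E C D = 0"
    using sp by (auto simp: two_split_def)
  have f: "finite C" "finite D" using CDV(2) finV by (metis finite_Diff finite_Un)+
  have i: "ind E {w, w'} = {(w, w')}" using ww asym[OF ww] irrefl[of w] irrefl[of w'] unfolding ind_def by blast
  then have wt: "wt E {w, w'} = 3" using wne by (simp add: wt_def)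
  have "acyc E ({w} \<union> {w'})"
    by (rule acyc_Un_oneway) (use irrefl asym[OF ww] in \<open>auto simp: acyc_def\<close>)
  then have ac: "acyc E {w, w'}" by (simp add: insert_commute)
  have cn: "conn E {w, w'}" using conn_insert[OF conn_singleton[of E w'], of w' w] ww by auto
  have b: "btw E X {w, w'} = btw E X {w} + btw E X {w'}" if "finite X" for X
    using btw_Un_right[of "{w}" "{w'}" X E] that wne by (simp add: insert_commute)
  obtain S where S: "S \<subseteq> C" "card S = tau E C" "acyc E (C \<union> {w, w'} - S)"
    by (rule extend_fvs[OF CD(1,3) cn ac]) (use q wt b f CDV YV ne in auto)
  obtain T where T: "T \<subseteq> D" "card T = tau E D" "acyc E (D \<union> {w, w'} - T)"
    by (rule extend_fvs[OF CD(2,4) cn ac]) (use q wt b f CDV YV ne in auto)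
  have "acyc E ((C \<union> {w, w'} - S) \<union> (D \<union> {w, w'} - T))"
  proof (rule acyc_glue_arc[OF _ _ _ ww asym[OF ww] S(3) T(3)])
    show "(C \<union> {w, w'} - S) \<inter> (D \<union> {w, w'} - T) = {w, w'}" using S(1) T(1) CDV by blast
    show "(x, z) \<notin> E \<and> (z, x) \<notin> E"
      if "x \<in> (C \<union> {w, w'} - S) - (D \<union> {w, w'} - T)" "z \<in> (D \<union> {w, w'} - T) - (C \<union> {w, w'} - S)" for x z
    proof -
      have "w \<notin> T" "w' \<notin> T" "w \<notin> S" "w' \<notin> S" using S(1) T(1) CDV(2) by auto
      then have "x \<in> C" "z \<in> D" using that by auto
      then show ?thesis using btw_eq_0D[OF f] b0 by simp
    qed
  qed (use f in auto)
  moreover have "V - insert y (S \<union> T) = (C \<union> {w, w'} - S) \<union> (D \<union> {w, w'} - T)"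
    using S(1) T(1) CDV YV ne by blast
  ultimately have "acyc E (V - insert y (S \<union> T))" by simp
  moreover have "insert y (S \<union> T) \<subseteq> V" using S(1) T(1) CDV(2) YV by blast
  ultimately have "tau E V \<le> card (insert y (S \<union> T))" by (intro tau_le)
  also have "\<dots> \<le> 1 + (card S + card T)"
    using card_insert_le_m1[of "Suc (card S + card T)" "S \<union> T" y] card_Un_le[of S T] by simp
  finally show False using two_split_tau[OF sp] S(2) T(2) by simp
qed

text \<open>Only \<open>y\<close> is deleted; \<open>w\<close> joins \<open>C\<close> and
  \<open>w'\<close> joins \<open>D\<close>. A single vertex has weight 1, so five arcs are
  affordable, and at most one arc then runs between the two acyclic sides.\<close>

lemma no_bridge_glue:
  assumes sp: "two_split {y, w, w'} C D" and ne: "y \<noteq> w" "y \<noteq> w'" "w \<noteq> w'"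
    and ww: "(w, w') \<notin> E" "(w', w) \<notin> E"
    and q: "btw E C {w} \<le> 5" "btw E D {w'} \<le> 5" "btw E C {w'} + btw E D {w} \<le> 1"
  shows False
proof -
  have YV: "{y, w, w'} \<subseteq> V" and CDV: "C \<inter> D = {}" "C \<union> D = V - {y, w, w'}"
    and CD: "conn E C" "conn E D" "exc E C = 1" "exc E D = 1" and b0: "btw E C D = 0"
    using sp by (auto simp: two_split_def)
  have f: "finite C" "finite D" using CDV(2) finV by (metis finite_Diff finite_Un)+
  have ac: "acyc E {x}" for x using irrefl by (auto simp: acyc_def)
  obtain S where S: "S \<subseteq> C" "card S = tau E C" "acyc E (C \<union> {w} - S)"
    by (rule extend_fvs[OF CD(1,3) conn_singleton ac, of w]) (use q wt_singleton CDV YV ne in auto)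
  obtain T where T: "T \<subseteq> D" "card T = tau E D" "acyc E (D \<union> {w'} - T)"
    by (rule extend_fvs[OF CD(2,4) conn_singleton ac, of w']) (use q wt_singleton CDV YV ne in auto)
  have "btw E (C \<union> {w}) (D \<union> {w'}) = btw E C (D \<union> {w'}) + btw E {w} (D \<union> {w'})"
    by (rule btw_Un_left) (use f CDV in auto)
  also have "\<dots> = btw E C D + btw E C {w'} + (btw E {w} D + btw E {w} {w'})"
    using btw_Un_right[of D "{w'}" C E] btw_Un_right[of D "{w'}" "{w}" E] f CDV by auto
  finally have le: "btw E (C \<union> {w}) (D \<union> {w'}) \<le> 1"
    using b0 q(3) btw_single[of w w'] ww by (simp add: btw_commute)
  have "btw E (C \<union> {w} - S) (D \<union> {w'} - T) \<le> btw E (C \<union> {w}) (D \<union> {w'})"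
    unfolding btw_def by (intro add_mono of_nat_mono card_mono) (use f in auto)
  then have "acyc E ((C \<union> {w} - S) \<union> (D \<union> {w'} - T))"
    by (intro acyc_Un_bridge) (use f S T le in auto)
  moreover have "V - insert y (S \<union> T) = (C \<union> {w} - S) \<union> (D \<union> {w'} - T)"
    using S(1) T(1) CDV YV ne by blast
  ultimately have "acyc E (V - insert y (S \<union> T))" by simp
  moreover have "insert y (S \<union> T) \<subseteq> V" using S(1) T(1) CDV(2) YV by blast
  ultimately have "tau E V \<le> card (insert y (S \<union> T))" by (intro tau_le)
  also have "\<dots> \<le> 1 + (card S + card T)"
    using card_insert_le_m1[of "Suc (card S + card T)" "S \<union> T" y] card_Un_le[of S T] by simp
  finally show False using two_split_tau[OF sp] S(2) T(2) by simp
qed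

lemma btw_outside:
  assumes "Y \<subseteq> V" "y \<in> Y"
  shows "btw E {y} (V - Y) = int (deg E y) - btw E {y} (Y - {y})"
proof -
  have "V - {y} = (V - Y) \<union> (Y - {y})" using assms by auto
  then have "btw E {y} (V - {y}) = btw E {y} (V - Y) + btw E {y} (Y - {y})"
    using btw_Un_right[of "V - Y" "Y - {y}" "{y}" E] finV fin[OF assms(1)] by auto
  then show ?thesis using btw_singleton[of y] assms by auto
qed

lemma two_split_btw:
  assumes sp: "two_split Y C D" and y: "y \<in> Y"
  shows "btw E C {y} + btw E D {y} = int (deg E y) - btw E {y} (Y - {y})"
proof -
  have "C \<inter> D = {}" "C \<union> D = V - Y" "Y \<subseteq> V" using sp by (auto simp: two_split_def)
  moreover then have "finite C" "finite D" using finV by (metis finite_Diff finite_Un)+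
  ultimately have "btw E (V - Y) {y} = btw E C {y} + btw E D {y}"
    using btw_Un_left[of C D "{y}" E] by simp
  then show ?thesis using btw_outside[of Y y] \<open>Y \<subseteq> V\<close> y by (simp add: btw_commute)
qed

lemma btw_insert3:
  assumes "finite X" "a \<noteq> b" "a \<noteq> c" "b \<noteq> c"
  shows "btw E X {a, b, c} = btw E X {a} + btw E X {b} + btw E X {c}"
    "btw E X {b, c} = btw E X {b} + btw E X {c}"
proof -
  show 1: "btw E X {b, c} = btw E X {b} + btw E X {c}"
    using btw_Un_right[of "{b}" "{c}" X E] assms by (simp add: insert_commute)
  show "btw E X {a, b, c} = btw E X {a} + btw E X {b} + btw E X {c}"
    using btw_Un_right[of "{a}" "{b, c}" X E] assms 1 by (simp add: insert_commute)
qed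

text \<open>Let \<open>z\<close> be the second out-neighbour of \<open>a\<close>. Deleting
  \<open>v\<close> and \<open>z\<close> makes \<open>a\<close> a sink, so \<open>{a, v, z}\<close>
  goes at cost 2. Adjacency of \<open>v\<close>, \<open>z\<close> and the degree of \<open>z\<close>
  decide between four vertices at cost 2, plain counting, and gluing.\<close>

lemma no_deg_5_in_2_aux:
  assumes v: "v \<in> V" "deg E v = 5" and ins: "E\<inverse> `` {v} = {a, b}" "a \<noteq> b" and a: "deg E a = 4"
  shows False
proof -
  have av: "(a, v) \<in> E" and bv: "(b, v) \<in> E" using ins by auto
  have aV: "a \<in> V" "b \<in> V" and nav: "a \<noteq> v" "b \<noteq> v" using av bv inV irrefl by auto
  have "card (E `` {a}) = 2" using deg_4D[OF aV(1) a] by simp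
  moreover have "v \<in> E `` {a}" using av by simp
  ultimately obtain z where z: "E `` {a} = {v, z}" "z \<noteq> v"
    by (metis card_2_iff doubleton_eq_iff insertE singletonD)
  have az: "(a, z) \<in> E" using z by auto
  have zV: "z \<in> V" and naz: "a \<noteq> z" using az inV irrefl by auto
  define Y where "Y = {a, v, z}"
  have Y: "Y \<subseteq> V" "card Y = 3" using aV v zV nav naz z by (auto simp: Y_def)
  have "tau E V \<le> 2 + tau E (V - insert a {v, z})"
    by (rule tau_delete_free) (use tau_delete_set[of "{v, z}"] v zV z in auto)
  then have k: "tau E V \<le> 2 + tau E (V - Y)" by (simp add: Y_def)
  have D: "(\<Sum>y\<in>Y. deg E y) = 9 + deg E z" using nav naz z a v by (simp add: Y_def)
  have iY: "ind E Y = {(a, v), (a, z)} \<union> (E \<inter> {(v, z), (z, v)})"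
    using av az asym[OF av] asym[OF az] irrefl[of a] irrefl[of v] irrefl[of z]
    unfolding ind_def Y_def by blast
  have qs: "btw E C {a} + btw E D {a} = 2"
    "btw E C {v} + btw E D {v} = 4 - btw E {v} {z}"
    "btw E C {z} + btw E D {z} = int (deg E z) - 1 - btw E {v} {z}"
    if sp: "two_split Y C D" for C D
  proof -
    have Ym: "Y - {a} = {v, z}" "Y - {v} = {a, z}" "Y - {z} = {a, v}" using nav naz z by (auto simp: Y_def)
    have "btw E {a} {v, z} = 2" using btw_insert3(2)[of "{a}" a v z] nav naz z av az by (simp add: btw_single)
    moreover have "btw E {v} {a, z} = 1 + btw E {v} {z}"
      using btw_insert3(2)[of "{v}" v a z] nav naz z av az by (simp add: btw_single)
    moreover have "btw E {z} {a, v} = 1 + btw E {v} {z}"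
      using btw_insert3(2)[of "{z}" z a v] nav naz z av az by (simp add: btw_single)
    ultimately show "btw E C {a} + btw E D {a} = 2"
      "btw E C {v} + btw E D {v} = 4 - btw E {v} {z}"
      "btw E C {z} + btw E D {z} = int (deg E z) - 1 - btw E {v} {z}"
      using two_split_btw[OF sp, of a] two_split_btw[OF sp, of v] two_split_btw[OF sp, of z] Ym a v
      by (simp_all add: Y_def)
  qed
  have perm: "Y = {z, a, v}" "Y = {v, a, z}" "Y = {a, z, v}" by (auto simp: Y_def)
  have bY: "btw E X Y = btw E X {a} + btw E X {v} + btw E X {z}" if "finite X" for X
    unfolding Y_def using btw_insert3(1)[OF that, of a v z] nav naz z by simp
  have fCD: "finite C" "finite D" if "two_split Y C D" for C D
    using that finV unfolding two_split_def by (metis finite_Diff finite_Un)+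
  show False
  proof (cases "(v, z) \<in> E \<or> (z, v) \<in> E")
    case True
    have ind3: "card (ind E Y) = 3"
    proof -
      have "E \<inter> {(v, z), (z, v)} = {(v, z)} \<or> E \<inter> {(v, z), (z, v)} = {(z, v)}"
        using True asym[of v z] asym[of z v] by auto
      then have "ind E Y = {(v, z), (a, v), (a, z)} \<or> ind E Y = {(z, v), (a, v), (a, z)}"
        by (elim disjE) (simp_all add: iY)
      then show ?thesis using z(2) nav naz by (elim disjE) simp_all
    qed
    show False
    proof (cases "deg E z = 4")
      case z4: True
      show False
        using True
      proof
        assume vz: "(v, z) \<in> E"
        have "card (E\<inverse> `` {z}) = 2" using deg_4D[OF zV z4] by simp
        moreover have "{a, v} \<subseteq> E\<inverse> `` {z}" using az vz by auto
        ultimately have inz: "E\<inverse> `` {z} = {a, v}"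
          using nav by (metis card_2_iff card_subset_eq finite.emptyI finite.insertI fin_nbrs(2))
        have zb: "z \<noteq> b" using asym[OF vz] bv by auto
        \<comment> \<open>Deleting both in-neighbours of \<open>v\<close> frees \<open>v\<close>,
          and then \<open>z\<close>, whose in-neighbours are \<open>a\<close> and
          \<open>v\<close>.\<close>
        have "tau E V \<le> 2 + tau E (V - insert v {a, b})"
          by (rule tau_delete_free) (use tau_delete_set[of "{a, b}"] aV ins in auto)
        then have "tau E V \<le> 2 + tau E (V - insert z (insert v {a, b}))"
          by (rule tau_delete_free) (use inz in auto)
        then show False
          by (rule delete_four_absurd[rotated 2]) (use aV v zV ins nav naz z zb in auto)
      next
        assume zv: "(z, v) \<in> E"
        then have zb: "z = b" using ins naz by auto
        have "card (E\<inverse> `` {z}) = 2" using deg_4D[OF zV z4] by simp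
        moreover have "a \<in> E\<inverse> `` {z}" using az by simp
        ultimately obtain c where c: "E\<inverse> `` {z} = {a, c}" "c \<noteq> a"
          by (metis card_2_iff doubleton_eq_iff insertE singletonD)
        have cz: "(c, z) \<in> E" using c by auto
        have cV: "c \<in> V" and nc: "c \<noteq> z" "c \<noteq> v" using cz inV irrefl asym[OF zv] by auto
        \<comment> \<open>Here \<open>z\<close> is the in-neighbour \<open>b\<close> of
          \<open>v\<close>: deleting the in-neighbours of \<open>z\<close> frees \<open>z\<close>
          and, since \<open>a\<close> is among them, also \<open>v\<close>.\<close>
        have "tau E V \<le> 2 + tau E (V - insert z {a, c})"
          by (rule tau_delete_free) (use tau_delete_set[of "{a, c}"] aV cV c in auto)
        then have "tau E V \<le> 2 + tau E (V - insert v (insert z {a, c}))"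
          by (rule tau_delete_free) (use ins zb in auto)
        then show False
          by (rule delete_four_absurd[rotated 2]) (use aV v zV cV c nav naz z nc in auto)
      qed
    next
      case False
      then have z5: "deg E z = 5" using deg_cases[OF zV] by auto
      have L: "btw E Y (V - Y) = 8" "wt E Y = 6"
        using wt_btw_deg[OF Y(1)] D z5 ind3 Y(2) by (simp_all flip: of_nat_sum)
      obtain C K where sp: "two_split Y C K" and q4: "4 \<le> btw E C Y" "4 \<le> btw E K Y"
        and sum: "btw E C Y + btw E K Y = btw E Y (V - Y)"
        by (rule two_splitI[OF Y k]) (use L in auto)
      have vz1: "btw E {v} {z} = 1" using True by (simp add: btw_single)
      note q = qs[OF sp, unfolded vz1 z5]
      have sumC: "btw E C {a} + btw E C {v} + btw E C {z} = 4" "btw E K {a} + btw E K {v} + btw E K {z} = 4"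
        using bY[of C] bY[of K] fCD[OF sp] q4 sum L by linarith+
      have nn: "0 \<le> btw E C {a}" "0 \<le> btw E C {v}" "0 \<le> btw E C {z}"
        "0 \<le> btw E K {a}" "0 \<le> btw E K {v}" "0 \<le> btw E K {z}" by (rule btw_nonneg)+
      \<comment> \<open>The vertices \<open>a\<close>, \<open>v\<close>, \<open>z\<close> send 2, 3
        and 3 arcs, four to each side. No subset of 2, 3, 3 sums to 4, so some vertex sends arcs to
        both sides; without it each side receives at most 3.\<close>
      have "btw E C {v} + btw E C {z} \<le> 3 \<and> btw E K {v} + btw E K {z} \<le> 3 \<or>
        btw E C {a} + btw E C {z} \<le> 3 \<and> btw E K {a} + btw E K {z} \<le> 3 \<or>
        btw E C {a} + btw E C {v} \<le> 3 \<and> btw E K {a} + btw E K {v} \<le> 3"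
        using q sumC nn by auto
      then consider "btw E C {v} + btw E C {z} \<le> 3" "btw E K {v} + btw E K {z} \<le> 3"
        | "btw E C {a} + btw E C {z} \<le> 3" "btw E K {a} + btw E K {z} \<le> 3"
        | "btw E C {a} + btw E C {v} \<le> 3" "btw E K {a} + btw E K {v} \<le> 3" by blast
      then show False
      proof cases
        case 1
        from True show False
        proof
          assume "(v, z) \<in> E"
          then show False using no_pair_glue[of a v z C K] sp 1 nav naz by (simp add: Y_def)
        next
          assume "(z, v) \<in> E"
          then show False using no_pair_glue[of a z v C K] sp 1 nav naz by (simp add: perm(3))
        qed
      next
        case 2
        then show False using no_pair_glue[of v a z C K] sp nav z az by (simp add: perm(2))
      next
        case 3
        then show False using no_pair_glue[of z a v C K] sp naz z av by (simp add: perm(1))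
      qed
    qed
  next
    case False
    then have ind2: "card (ind E Y) = 2"
      using iY z(2) by (simp add: Int_insert_right)
    show False
    proof (cases "deg E z = 5")
      case True
      show False by (rule delete_absurd[OF Y _ k D]) (use ind2 True in auto)
    next
      case False
      then have z4: "deg E z = 4" using deg_cases[OF zV] by auto
      have L: "btw E Y (V - Y) = 9" "wt E Y = 5"
        using wt_btw_deg[OF Y(1)] D z4 ind2 Y(2) by (simp_all flip: of_nat_sum)
      obtain C K where sp: "two_split Y C K" and q4: "4 \<le> btw E C Y" "4 \<le> btw E K Y"
        and sum: "btw E C Y + btw E K Y = btw E Y (V - Y)"
        by (rule two_splitI[OF Y k]) (use L in auto)
      have nvz: "(v, z) \<notin> E" "(z, v) \<notin> E" using \<open>\<not> ((v, z) \<in> E \<or> (z, v) \<in> E)\<close> by auto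
      have vz0: "btw E {v} {z} = 0" using nvz by (simp add: btw_single)
      note q = qs[OF sp, unfolded vz0 z4]
      have sumC: "4 \<le> btw E C {a} + btw E C {v} + btw E C {z}" "4 \<le> btw E K {a} + btw E K {v} + btw E K {z}"
        "btw E C {a} + btw E C {v} + btw E C {z} + (btw E K {a} + btw E K {v} + btw E K {z}) = 9"
        using bY[of C] bY[of K] fCD[OF sp] q4 sum L by linarith+
      have nn: "0 \<le> btw E C {a}" "0 \<le> btw E C {v}" "0 \<le> btw E C {z}"
        "0 \<le> btw E K {a}" "0 \<le> btw E K {v}" "0 \<le> btw E K {z}" by (rule btw_nonneg)+
      \<comment> \<open>Now 2, 4 and 3 arcs leave \<open>a\<close>, \<open>v\<close>,
        \<open>z\<close>, split as 4 and 5. If neither pair gluing works, \<open>v\<close> and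
        \<open>z\<close> lean to opposite sides with at most one stray arc between them.\<close>
      have "btw E C {a} + btw E C {z} \<le> 3 \<and> btw E K {a} + btw E K {z} \<le> 3 \<or>
        btw E C {a} + btw E C {v} \<le> 3 \<and> btw E K {a} + btw E K {v} \<le> 3 \<or>
        btw E C {z} + btw E K {v} \<le> 1 \<or> btw E C {v} + btw E K {z} \<le> 1"
        using q sumC nn by (smt (verit) of_nat_numeral)
      then consider "btw E C {a} + btw E C {z} \<le> 3" "btw E K {a} + btw E K {z} \<le> 3"
        | "btw E C {a} + btw E C {v} \<le> 3" "btw E K {a} + btw E K {v} \<le> 3"
        | "btw E C {z} + btw E K {v} \<le> 1" | "btw E C {v} + btw E K {z} \<le> 1" by blast
      then show False
      proof cases
        case 1
        then show False using no_pair_glue[of v a z C K] sp nav z az by (simp add: perm(2))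
      next
        case 2
        then show False using no_pair_glue[of z a v C K] sp naz z av by (simp add: perm(1))
      next
        case 3
        then show False using no_bridge_glue[of a v z C K] sp nav naz z nvz q nn by (simp add: Y_def)
      next
        case 4
        then show False using no_bridge_glue[of a z v C K] sp nav naz z nvz q nn by (simp add: perm(3))
      qed
    qed
  qed
qed

lemma no_deg_5_in_2:
  assumes v: "v \<in> V" "deg E v = 5" and i2: "card (E\<inverse> `` {v}) = 2"
  shows False
proof -
  obtain a b where ab: "E\<inverse> `` {v} = {a, b}" "a \<noteq> b" using i2 by (auto simp: card_2_iff)
  have arcs: "(a, v) \<in> E" "(b, v) \<in> E" using ab by auto
  have V: "a \<in> V" "b \<in> V" and ne: "a \<noteq> v" "b \<noteq> v" using arcs inV irrefl by auto
  consider "deg E a = 4" | "deg E b = 4" | "deg E a = 5" "deg E b = 5"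
    using deg_cases[OF V(1)] deg_cases[OF V(2)] by blast
  then show False
  proof cases
    case 1
    then show False using no_deg_5_in_2_aux[OF v ab] by simp
  next
    case 2
    then show False using no_deg_5_in_2_aux[OF v, of b a] ab by (simp add: insert_commute)
  next
    case 3
    \<comment> \<open>Degree sum 15 and at most three inner arcs at cost 2: plain counting
      suffices.\<close>
    have k: "tau E V \<le> 2 + tau E (V - insert v {a, b})"
      by (rule tau_delete_free) (use tau_delete_set[of "{a, b}"] V ab in auto)
    have c: "card {v, a, b} = 3" using ab ne by auto
    show False
    proof (rule delete_absurd[OF _ c _ k])
      show "(\<Sum>y\<in>{v, a, b}. deg E y) = 15" using 3 v ab ne by auto
      show "card (ind E {v, a, b}) \<le> 3" using card_ind_le[OF _ asym, of "{v, a, b}"] c by simp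
    qed (use V v in auto)
  qed
qed

lemma regular_4:
  assumes v: "v \<in> V"
  shows "deg E v = 4" "card (E `` {v}) = 2" "card (E\<inverse> `` {v}) = 2"
proof -
  interpret d: mincex "E\<inverse>" V by (rule dual)
  have "deg E v \<noteq> 5"
  proof
    assume 5: "deg E v = 5"
    then have "card (E\<inverse> `` {v}) = 2 \<or> card (E `` {v}) = 2"
      using indeg_ge_2[OF v] outdeg_ge_2[OF v] by (auto simp: deg_def)
    then show False
      using no_deg_5_in_2[OF v 5] d.no_deg_5_in_2[OF v] 5 by (auto simp: deg_converse)
  qed
  then show "deg E v = 4" using deg_cases[OF v] by simp
  then show "card (E `` {v}) = 2" "card (E\<inverse> `` {v}) = 2" using deg_4D[OF v] by auto
qed

end

subsection \<open>The four-regular case\<close>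

text \<open>Deleting \<open>v\<close>, \<open>a\<close> and \<open>b\<close> turns both out-neighbours \<open>u\<close>, \<open>u'\<close> of \<open>v\<close> into sources.\<close>

definition fan4 :: "('a \<times> 'a) set \<Rightarrow> 'a \<Rightarrow> 'a \<Rightarrow> 'a \<Rightarrow> 'a \<Rightarrow> 'a \<Rightarrow> bool" where
  "fan4 E v u u' a b \<longleftrightarrow> E `` {v} = {u, u'} \<and> E\<inverse> `` {u} = {v, a} \<and> E\<inverse> `` {u'} = {v, b} \<and>
     distinct [v, u, u', a, b]"

definition fan :: "('a \<times> 'a) set \<Rightarrow> 'a \<Rightarrow> 'a set \<Rightarrow> bool" where
  "fan E v Y \<longleftrightarrow> (\<exists>u u' a b. fan4 E v u u' a b \<and> Y = {v, u, u', a, b})"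

definition nbd :: "('a \<times> 'a) set \<Rightarrow> 'a set \<Rightarrow> 'a set" where
  "nbd E K = {y. y \<notin> K \<and> (\<exists>x\<in>K. (x, y) \<in> E \<or> (y, x) \<in> E)}"

lemma comps_converse: "comps (E\<inverse>) W = comps E W"
  by (auto simp: comps_def)

lemma fan4_commute: "fan4 E v u u' a b \<Longrightarrow> fan4 E v u' u b a"
  by (auto simp: fan4_def)

lemma fan4D:
  assumes "fan4 E v u u' a b"
  shows "(v, u) \<in> E" "(v, u') \<in> E" "(a, u) \<in> E" "(b, u') \<in> E"
    "\<And>q. (v, q) \<in> E \<Longrightarrow> q = u \<or> q = u'" "\<And>p. (p, u) \<in> E \<Longrightarrow> p = v \<or> p = a"
    "\<And>p. (p, u') \<in> E \<Longrightarrow> p = v \<or> p = b" "distinct [v, u, u', a, b]"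
    "E `` {v} = {u, u'}" "E\<inverse> `` {u} = {v, a}" "E\<inverse> `` {u'} = {v, b}"
  using assms unfolding fan4_def by auto

text \<open>The remaining vertices of a fan are one or two steps away from \<open>w\<close>;
  entering \<open>K\<close> needs a last step from \<open>nbd E K\<close>. Taking \<open>F\<close>
  as \<open>E\<close> or its converse covers both kinds of fans.\<close>

lemma fan_avoids:
  assumes fan: "fan F w Y" and F: "F = E \<or> F = E\<inverse>"
    and w: "w \<notin> K" "w \<notin> nbd E K" "\<And>u. (w, u) \<in> F \<Longrightarrow> u \<notin> nbd E K"
  shows "Y \<inter> K = {}"
proof -
  obtain u u' a b where f: "fan4 F w u u' a b" and Y: "Y = {w, u, u', a, b}"
    using fan by (auto simp: fan_def)
  note d = fan4D[OF f]
  have adj: "(x, y) \<in> E \<or> (y, x) \<in> E" if "(x, y) \<in> F" for x y using F that by auto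
  have "u \<notin> K" using adj[OF d(1)] w(1,2) unfolding nbd_def by blast
  moreover have "u' \<notin> K" using adj[OF d(2)] w(1,2) unfolding nbd_def by blast
  moreover have "a \<notin> K" using adj[OF d(3)] w(3)[OF d(1)] \<open>u \<notin> K\<close> unfolding nbd_def by blast
  moreover have "b \<notin> K" using adj[OF d(4)] w(3)[OF d(2)] \<open>u' \<notin> K\<close> unfolding nbd_def by blast
  ultimately show ?thesis using w(1) Y by blast
qed

lemma btw_sum_left:
  assumes "finite D" "finite Y" shows "btw E D Y = (\<Sum>w\<in>D. btw E {w} Y)"
  using assms(1)
proof (induction D rule: finite_induct)
  case (insert w D)
  then show ?case using btw_Un_left[of "{w}" D Y E] assms(2) by simp
qed simp

lemma btw_mono:
  assumes "finite X'" "finite Y'" "X \<subseteq> X'" "Y \<subseteq> Y'" shows "btw E X Y \<le> btw E X' Y'"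
  unfolding btw_def by (intro add_mono of_nat_mono card_mono) (use assms in auto)

section \<open>Forbidden local configurations with two in-arcs and two out-arcs everywhere\<close>

context mincex begin

lemma in_pair:
  assumes "(a, v) \<in> E"
  obtains b where "E\<inverse> `` {v} = {a, b}" "b \<noteq> a" "(b, v) \<in> E"
proof -
  have "card (E\<inverse> `` {v}) = 2" using regular_4(3) inV(2)[OF assms] by blast
  moreover have "a \<in> E\<inverse> `` {v}" using assms by simp
  ultimately obtain b where "E\<inverse> `` {v} = {a, b}" "b \<noteq> a"
    by (metis card_2_iff doubleton_eq_iff insertE singletonD)
  moreover then have "(b, v) \<in> E" by auto
  ultimately show ?thesis using that by blast
qed

lemma out_pair:
  assumes "(v, a) \<in> E"
  obtains b where "E `` {v} = {a, b}" "b \<noteq> a" "(v, b) \<in> E"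
proof -
  have "card (E `` {v}) = 2" using regular_4(2) inV(1)[OF assms] by blast
  moreover have "a \<in> E `` {v}" using assms by simp
  ultimately obtain b where "E `` {v} = {a, b}" "b \<noteq> a"
    by (metis card_2_iff doubleton_eq_iff insertE singletonD)
  moreover then have "(v, b) \<in> E" by auto
  ultimately show ?thesis using that by blast
qed

lemma in_eq: "(a, v) \<in> E \<Longrightarrow> (b, v) \<in> E \<Longrightarrow> a \<noteq> b \<Longrightarrow> E\<inverse> `` {v} = {a, b}"
  by (erule in_pair) auto

lemma out_eq: "(v, a) \<in> E \<Longrightarrow> (v, b) \<in> E \<Longrightarrow> a \<noteq> b \<Longrightarrow> E `` {v} = {a, b}"
  by (erule out_pair) auto

lemma arc_ne: "(a, b) \<in> E \<Longrightarrow> a \<noteq> b" using irrefl by auto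

text \<open>The in-neighbours of \<open>x\<close> are \<open>a\<close> and \<open>u\<close>.
  Deleting \<open>a\<close> and the other in-neighbour of \<open>u\<close> frees \<open>u\<close>
  and then \<open>x\<close>: four vertices at cost 2.\<close>

lemma no_transitive:
  assumes "(a, u) \<in> E" "(u, x) \<in> E" "(a, x) \<in> E"
  shows False
proof -
  obtain p where p: "E\<inverse> `` {u} = {a, p}" "p \<noteq> a" "(p, u) \<in> E" by (rule in_pair[OF assms(1)])
  have ne: "a \<noteq> u" "u \<noteq> x" "a \<noteq> x" "p \<noteq> u" "p \<noteq> x"
    using arc_ne[OF assms(1)] arc_ne[OF assms(2)] arc_ne[OF assms(3)] arc_ne[OF p(3)]
      asym[OF assms(2)] p(3) by auto
  have x: "E\<inverse> `` {x} = {a, u}" by (rule in_eq) (use assms ne in auto)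
  have V: "a \<in> V" "u \<in> V" "x \<in> V" "p \<in> V" using inV assms p(3) by blast+
  have "tau E V \<le> 2 + tau E (V - insert u {a, p})"
    by (rule tau_delete_free) (use tau_delete_set[of "{a, p}"] V p in auto)
  then have "tau E V \<le> 2 + tau E (V - insert x (insert u {a, p}))"
    by (rule tau_delete_free) (use x in auto)
  then show False by (rule delete_four_absurd[rotated 2]) (use V ne p in auto)
qed

text \<open>Deleting the shared pair of neighbours frees both \<open>u\<close> and \<open>x\<close>,
  again four vertices at cost 2.\<close>

lemma no_twins:
  assumes V: "u \<in> V" "x \<in> V"
  shows "E\<inverse> `` {u} = E\<inverse> `` {x} \<Longrightarrow> u = x" and "E\<inverse> `` {u} \<noteq> E `` {x}"
proof -
  obtain p q where pq: "E\<inverse> `` {u} = {p, q}" "p \<noteq> q"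
    using regular_4(3)[OF V(1)] by (auto simp: card_2_iff)
  have arcs: "(p, u) \<in> E" "(q, u) \<in> E" using pq by auto
  have pV: "p \<in> V" "q \<in> V" "u \<noteq> p" "u \<noteq> q" using inV arcs arc_ne by blast+
  have 1: "tau E V \<le> 2 + tau E (V - insert u {p, q})"
    by (rule tau_delete_free) (use tau_delete_set[of "{p, q}"] pV pq in auto)
  have 2: False if "E\<inverse> `` {x} \<subseteq> {p, q} \<or> E `` {x} \<subseteq> {p, q}" "x \<notin> {u, p, q}"
  proof -
    have "tau E V \<le> 2 + tau E (V - insert x (insert u {p, q}))"
      by (rule tau_delete_free[OF 1]) (use that in auto)
    then show False by (rule delete_four_absurd[rotated 2]) (use V pV pq that in auto)
  qed
  show "u = x" if eq: "E\<inverse> `` {u} = E\<inverse> `` {x}"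
  proof (rule ccontr)
    assume "u \<noteq> x"
    have "(p, x) \<in> E" "(q, x) \<in> E" using eq pq by auto
    then show False using 2 eq pq \<open>u \<noteq> x\<close> arc_ne by blast
  qed
  show "E\<inverse> `` {u} \<noteq> E `` {x}"
  proof
    assume eq: "E\<inverse> `` {u} = E `` {x}"
    have x: "(x, p) \<in> E" "(x, q) \<in> E" using eq pq by auto
    then have "u \<noteq> x" using arcs asym by blast
    then show False using 2 eq pq x arc_ne by blast
  qed
qed

text \<open>The outer vertices \<open>a\<close> and \<open>b\<close> differ because there are no
  twins, and they avoid \<open>u'\<close> and \<open>u\<close> because there is no transitive
  triangle.\<close>

lemma fan_exists: assumes "v \<in> V" obtains Y where "fan E v Y"
proof -
  obtain u u' where u: "E `` {v} = {u, u'}" "u \<noteq> u'"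
    using regular_4(2)[OF assms] by (auto simp: card_2_iff)
  have vu: "(v, u) \<in> E" "(v, u') \<in> E" using u by auto
  obtain a where a: "E\<inverse> `` {u} = {v, a}" "a \<noteq> v" "(a, u) \<in> E" by (rule in_pair[OF vu(1)])
  obtain b where b: "E\<inverse> `` {u'} = {v, b}" "b \<noteq> v" "(b, u') \<in> E" by (rule in_pair[OF vu(2)])
  have "a \<noteq> b" using no_twins(1)[of u u'] a(1) b(1) u(2) inV vu by blast
  moreover have "a \<noteq> u'" "b \<noteq> u"
    using no_transitive[OF vu(2) _ vu(1)] no_transitive[OF vu(1) _ vu(2)] a b by auto
  moreover have "a \<noteq> u" "b \<noteq> u'" "v \<noteq> u" "v \<noteq> u'"
    using arc_ne[OF a(3)] arc_ne[OF b(3)] arc_ne[OF vu(1)] arc_ne[OF vu(2)] by auto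
  ultimately have "fan4 E v u u' a b" using u a b by (auto simp: fan4_def)
  then show ?thesis using that unfolding fan_def by blast
qed

text \<open>Let \<open>c\<close> be the other in-neighbour of \<open>b\<close>. Deleting
  \<open>v\<close>, \<open>a\<close>, \<open>c\<close> frees \<open>u\<close> and \<open>b\<close>,
  and then \<open>u'\<close>: six vertices at cost 3, which is absurd with at most nine inner
  arcs.\<close>

lemma fan4_no_ab:
  assumes f: "fan4 E v u u' a b" and ab: "(a, b) \<in> E"
  shows False
proof -
  note d = fan4D[OF f]
  obtain c where c: "E\<inverse> `` {b} = {a, c}" "c \<noteq> a" "(c, b) \<in> E" by (rule in_pair[OF ab])
  have inb: "p = a \<or> p = c" if "(p, b) \<in> E" for p using that c(1) by auto
  have outa: "q = u \<or> q = b" if "(a, q) \<in> E" for q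
    using that out_eq[OF d(3) ab] d(8) by auto
  have ne: "c \<noteq> v" "c \<noteq> u'" "c \<noteq> b" "c \<noteq> u"
    using d(5)[of b] d(8) c(3) asym[OF d(4)] arc_ne[OF c(3)] no_transitive[OF d(3) _ ab] by auto
  define Y where "Y = {u', b, u, v, a, c}"
  have V: "v \<in> V" "u \<in> V" "u' \<in> V" "a \<in> V" "b \<in> V" "c \<in> V"
    using inV[OF d(1)] inV[OF d(2)] inV[OF ab] inV[OF c(3)] by auto
  have YV: "Y \<subseteq> V" using V by (simp add: Y_def)
  have cY: "card Y = 6" using d(8) c(2) ne by (simp add: Y_def eq_commute)
  have "card {v, a, c} = 3" using d(8) ne c(2) by (simp add: eq_commute)
  then have "tau E V \<le> 3 + tau E (V - {v, a, c})" using tau_delete_set[of "{v, a, c}"] V by simp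
  then have "tau E V \<le> 3 + tau E (V - insert u {v, a, c})"
    by (rule tau_delete_free) (use d in auto)
  then have "tau E V \<le> 3 + tau E (V - insert b (insert u {v, a, c}))"
    by (rule tau_delete_free) (use c in auto)
  then have "tau E V \<le> 3 + tau E (V - insert u' (insert b (insert u {v, a, c})))"
    by (rule tau_delete_free) (use d in auto)
  then have k: "tau E V \<le> 3 + tau E (V - Y)" by (simp add: Y_def)
  have no: "(c, a) \<notin> E" "(u, v) \<notin> E" "(u, a) \<notin> E" "(b, v) \<notin> E" "(b, a) \<notin> E" "(b, c) \<notin> E" "(u', v) \<notin> E"
    using no_transitive[OF _ ab c(3)] asym[OF d(1)] asym[OF d(3)] no_transitive[OF _ d(2,4)]
      asym[OF ab] asym[OF c(3)] asym[OF d(2)] by blast+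
  define R where "R = {(v, u), (v, u'), (a, u), (b, u'), (a, b), (c, b), (c, v), (u, c), (u', c), (u', a)}"
  have sub: "ind E Y \<subseteq> R"
  proof
    fix e assume "e \<in> ind E Y"
    then obtain p q where e: "e = (p, q)" "(p, q) \<in> E" "p \<in> Y" "q \<in> Y" by (auto simp: ind_def)
    show "e \<in> R"
    proof (cases "q \<in> {u, u', b}")
      case True
      then have "q = u \<and> (p = v \<or> p = a) \<or> q = u' \<and> (p = v \<or> p = b) \<or> q = b \<and> (p = a \<or> p = c)"
        using d(6,7) inb e(2) by blast
      then show ?thesis unfolding R_def e(1) by (elim disjE conjE; simp)
    next
      case False
      then have "p \<noteq> v" "p \<noteq> a" using d(5) outa e(2) by blast+
      then have pq: "p = c \<or> p = u \<or> p = b \<or> p = u'" "q = v \<or> q = a \<or> q = c"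
        using False e(3,4) unfolding Y_def by blast+
      then show ?thesis using e(2) no irrefl[of c] unfolding R_def e(1)
        by (elim disjE; simp)
    qed
  qed
  \<comment> \<open>Ten arcs are still possible, one too many. If \<open>u'\<close> sent arcs to
    both \<open>a\<close> and \<open>c\<close>, its out-neighbours would be the in-neighbours of
    \<open>b\<close>.\<close>
  have "\<not> ((u', c) \<in> E \<and> (u', a) \<in> E)"
  proof
    assume "(u', c) \<in> E \<and> (u', a) \<in> E"
    then have "E `` {u'} = {a, c}" by (intro out_eq) (use c in auto)
    then show False using no_twins(2)[of b u'] V c(1) by simp
  qed
  then have "ind E Y \<subseteq> R - {(u', c)} \<or> ind E Y \<subseteq> R - {(u', a)}"
    using sub by (auto simp: ind_def)
  moreover have fR: "finite R" and "card R \<le> 10"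
    unfolding R_def using card_length[of "[(v, u), (v, u'), (a, u), (b, u'), (a, b), (c, b), (c, v), (u, c), (u', c), (u', a)]"]
    by simp_all
  moreover have "(u', c) \<in> R" "(u', a) \<in> R" by (auto simp: R_def)
  moreover have "card (R - {p}) \<le> 9" if "p \<in> R" for p
    using card_Diff_singleton[OF that] \<open>card R \<le> 10\<close> by simp
  ultimately have e: "card (ind E Y) \<le> 9"
    by (meson card_mono finite_Diff order_trans)
  have "(\<Sum>y\<in>Y. deg E y) = (\<Sum>y\<in>Y. 4)" by (rule sum.cong) (use YV regular_4(1) in auto)
  then have D: "(\<Sum>y\<in>Y. deg E y) = 24" using cY by simp
  show False by (rule delete_absurd[OF YV cY _ k D e]) auto
qed

text \<open>\<open>in_triangle\<close> at \<open>u'\<close> is used for each in-neighbour. The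
  out-neighbour \<open>a\<close> cannot close either triangle, so the other one, \<open>r\<close>,
  closes both; its out-neighbours are then the in-neighbours of \<open>u'\<close>.\<close>

lemma fan4_no_ua:
  assumes f: "fan4 E v u u' a b" and ua: "(u', a) \<in> E"
  shows False
proof -
  note d = fan4D[OF f]
  obtain r where r: "E `` {u'} = {a, r}" "r \<noteq> a" "(u', r) \<in> E" by (rule out_pair[OF ua])
  have vb: "v \<noteq> b" using d(8) by simp
  obtain x where x: "(u', x) \<in> E" "(x, b) \<in> E" using in_triangle[OF d(11) vb] .
  have "E\<inverse> `` {u'} = {b, v}" using d(11) by auto
  then obtain x' where x': "(u', x') \<in> E" "(x', v) \<in> E" using in_triangle[of u' b v] vb by blast
  have "(a, v) \<notin> E" using no_transitive[OF _ d(1,3)] by blast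
  then have "x' = r" using x' r(1) by auto
  have "x \<noteq> a" using fan4_no_ab[OF f] x by blast
  then have "x = r" using x r(1) by auto
  then have "E `` {r} = {v, b}" by (intro out_eq) (use x x' \<open>x' = r\<close> vb in auto)
  moreover have "u' \<in> V" "r \<in> V" using inV[OF r(3)] by auto
  ultimately show False using no_twins(2)[of u' r] d(11) by simp
qed

lemma fan4_ind:
  assumes f: "fan4 E v u u' a b"
  shows "ind E {v, u, u', a, b} = {(v, u), (v, u'), (a, u), (b, u')}"
proof
  note d = fan4D[OF f]
  note f' = fan4_commute[OF f]
  show "{(v, u), (v, u'), (a, u), (b, u')} \<subseteq> ind E {v, u, u', a, b}" using d(1-4) by (auto simp: ind_def)
  have no: "(u, v) \<notin> E" "(u, a) \<notin> E" "(u, b) \<notin> E" "(u', v) \<notin> E" "(u', a) \<notin> E" "(u', b) \<notin> E"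
    "(a, v) \<notin> E" "(a, b) \<notin> E" "(b, v) \<notin> E" "(b, a) \<notin> E" "(a, a) \<notin> E" "(b, b) \<notin> E"
    using asym[OF d(1)] asym[OF d(2)] asym[OF d(3)] asym[OF d(4)] fan4_no_ab[OF f] fan4_no_ab[OF f']
      fan4_no_ua[OF f] fan4_no_ua[OF f'] no_transitive[OF _ d(1,3)] no_transitive[OF _ d(2,4)] irrefl by blast+
  show "ind E {v, u, u', a, b} \<subseteq> {(v, u), (v, u'), (a, u), (b, u')}"
  proof
    fix e assume "e \<in> ind E {v, u, u', a, b}"
    then obtain p q where e: "e = (p, q)" "(p, q) \<in> E" "p \<in> {v, u, u', a, b}" "q \<in> {v, u, u', a, b}"
      by (auto simp: ind_def)
    show "e \<in> {(v, u), (v, u'), (a, u), (b, u')}"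
    proof (cases "q \<in> {u, u'}")
      case True
      then show ?thesis using e d(6)[of p] d(7)[of p] by auto
    next
      case False
      then have "p \<noteq> v" using d(5)[of q] e by auto
      then show ?thesis using False e no by auto
    qed
  qed
qed

text \<open>With four inner arcs the weight is 5 + 4 and the boundary has 20 - 8 arcs. Since 9 + 12
  = 7 * 3, the balance is 0: two bad components are guaranteed, but the counting test alone gives no
  contradiction.\<close>

lemma fan_facts:
  assumes "fan E v Y"
  shows "Y \<subseteq> V" "card Y = 5" "tau E V \<le> 3 + tau E (V - Y)" "wt E Y = 9" "btw E Y (V - Y) = 12"
proof -
  obtain u u' a b where f: "fan4 E v u u' a b" and Y: "Y = {v, u, u', a, b}"
    using assms by (auto simp: fan_def)
  note d = fan4D[OF f]
  have V: "v \<in> V" "u \<in> V" "u' \<in> V" "a \<in> V" "b \<in> V"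
    using inV[OF d(1)] inV[OF d(2)] inV[OF d(3)] inV[OF d(4)] by auto
  then show YV: "Y \<subseteq> V" by (simp add: Y)
  show c: "card Y = 5" using d(8) by (simp add: Y)
  have "tau E V \<le> 3 + tau E (V - {v, a, b})" using tau_delete_set[of "{v, a, b}"] V d(8) by simp
  then have "tau E V \<le> 3 + tau E (V - insert u {v, a, b})"
    by (rule tau_delete_free) (use d in auto)
  then have "tau E V \<le> 3 + tau E (V - insert u' (insert u {v, a, b}))"
    by (rule tau_delete_free) (use d in auto)
  moreover have "insert u' (insert u {v, a, b}) = Y" by (auto simp: Y)
  ultimately show "tau E V \<le> 3 + tau E (V - Y)" by simp
  have e: "card (ind E Y) = 4" using fan4_ind[OF f] d(8) by (auto simp: Y)
  have "(\<Sum>y\<in>Y. int (deg E y)) = (\<Sum>y\<in>Y. 4)" by (rule sum.cong) (use YV regular_4(1) in auto)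
  then show "wt E Y = 9" "btw E Y (V - Y) = 12" using wt_btw_deg[OF YV] e c by simp_all
qed

text \<open>\<open>in_triangle\<close> at \<open>x\<close> yields an arc from the out-neighbour
  \<open>r\<close> of \<open>x\<close> to the in-neighbour \<open>p\<close>, both off the triangle
  and hence in \<open>Y\<close>. Arcs inside a fan end in \<open>u\<close> or
  \<open>u'\<close>.\<close>

lemma fan_triangle_aux:
  assumes f: "fan4 E v u u' a b" and Y: "Y = {v, u, u', a, b}"
    and cl: "\<And>p q. p \<in> {x, y, z} \<Longrightarrow> q \<in> V \<Longrightarrow> q \<notin> {x, y, z} \<Longrightarrow> (p, q) \<in> E \<or> (q, p) \<in> E \<Longrightarrow> q \<in> Y"
    and cyc: "(x, y) \<in> E" "(y, z) \<in> E" "(z, x) \<in> E"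
  shows "(u, x) \<in> E \<or> (u', x) \<in> E"
proof -
  obtain p where p: "E\<inverse> `` {x} = {z, p}" "p \<noteq> z" "(p, x) \<in> E" by (rule in_pair[OF cyc(3)])
  obtain r where r: "E `` {x} = {y, r}" "r \<noteq> y" "(x, r) \<in> E" by (rule out_pair[OF cyc(1)])
  obtain s where s: "(x, s) \<in> E" "(s, p) \<in> E" using in_triangle[OF p(1)] p(2) by blast
  have "s \<noteq> y"
  proof
    assume "s = y"
    then have "E `` {y} = {z, p}" by (intro out_eq) (use cyc s p in auto)
    then show False using no_twins(2)[of x y] inV[OF cyc(1)] p(1) by simp
  qed
  then have "s = r" using s(1) r(1) by auto
  have "p \<notin> {x, y, z}" using arc_ne[OF p(3)] asym[OF cyc(1)] p by auto
  then have "p \<in> Y" using cl[of x p] inV[OF p(3)] p(3) by blast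
  moreover have "r \<notin> {x, y, z}" using arc_ne[OF r(3)] asym[OF cyc(3)] r by auto
  then have "r \<in> Y" using cl[of x r] inV[OF r(3)] r(3) by blast
  ultimately have "(r, p) \<in> ind E Y" using s \<open>s = r\<close> by (auto simp: ind_def)
  then have "p = u \<or> p = u'" using fan4_ind[OF f] Y by auto
  then show ?thesis using p(3) by auto
qed

text \<open>By pigeonhole \<open>u\<close> or \<open>u'\<close> sends arcs to two vertices of the
  triangle, which makes a transitive triangle.\<close>

lemma fan_no_triangle:
  assumes fan: "fan E v Y" and D: "D \<in> comps E (V - Y)" "D = {x, y, z}"
    and cyc: "(x, y) \<in> E" "(y, z) \<in> E" "(z, x) \<in> E"
  shows False
proof -
  obtain u u' a b where f: "fan4 E v u u' a b" and Y: "Y = {v, u, u', a, b}"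
    using fan by (auto simp: fan_def)
  have cl: "q \<in> Y" if "p \<in> {x, y, z}" "q \<in> V" "q \<notin> {x, y, z}" "(p, q) \<in> E \<or> (q, p) \<in> E" for p q
    using compsD(3)[OF D(1), of p q] that D(2) by blast
  have perm: "{y, z, x} = {x, y, z}" "{z, x, y} = {x, y, z}" by auto
  have x: "(u, x) \<in> E \<or> (u', x) \<in> E" by (rule fan_triangle_aux[OF f Y _ cyc]) (use cl in blast)
  have y: "(u, y) \<in> E \<or> (u', y) \<in> E"
    by (rule fan_triangle_aux[OF f Y _ cyc(2,3,1)]) (use cl perm in blast)
  have z: "(u, z) \<in> E \<or> (u', z) \<in> E"
    by (rule fan_triangle_aux[OF f Y _ cyc(3,1,2)]) (use cl perm in blast)
  have no: "\<not> ((p, x) \<in> E \<and> (p, y) \<in> E)" "\<not> ((p, y) \<in> E \<and> (p, z) \<in> E)" "\<not> ((p, z) \<in> E \<and> (p, x) \<in> E)" for p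
    using no_transitive[OF _ cyc(1)] no_transitive[OF _ cyc(2)] no_transitive[OF _ cyc(3)] by blast+
  show False using x y z no[of u] no[of u'] by blast
qed

lemma three_cycle:
  assumes "card D = 3" "D \<subseteq> V" "card (ind E D) = 3"
  obtains x y z where "D = {x, y, z}" "(x, y) \<in> E" "(y, z) \<in> E" "(z, x) \<in> E"
proof -
  obtain x y z where D: "D = {x, y, z}" "x \<noteq> y" "y \<noteq> z" "x \<noteq> z"
    using assms(1) by (auto simp: card_3_iff)
  have "wt E ({x} \<union> {y, z}) = wt E {x} + wt E {y, z} + btw E {x} {y, z}"
    by (rule wt_Un) (use D in auto)
  moreover have "wt E ({y} \<union> {z}) = wt E {y} + wt E {z} + btw E {y} {z}"
    by (rule wt_Un) (use D in auto)
  moreover have "btw E {x} {y, z} = btw E {x} {y} + btw E {x} {z}"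
    by (rule btw_insert3(2)[of _ x]) (use D in auto)
  moreover have "wt E D = 6" using assms by (simp add: wt_def)
  ultimately have "btw E {y} {z} + btw E {x} {y} + btw E {x} {z} = 3"
    using D(1) by (simp add: wt_singleton insert_commute)
  then have adj: "(y, z) \<in> E \<or> (z, y) \<in> E" "(x, y) \<in> E \<or> (y, x) \<in> E" "(x, z) \<in> E \<or> (z, x) \<in> E"
    by (auto simp: btw_single split: if_splits)
  then have "(x, y) \<in> E \<and> (y, z) \<in> E \<and> (z, x) \<in> E \<or> (x, z) \<in> E \<and> (z, y) \<in> E \<and> (y, x) \<in> E"
    using no_transitive[of x y z] no_transitive[of x z y] no_transitive[of y x z]
      no_transitive[of y z x] no_transitive[of z x y] no_transitive[of z y x] by blast
  then show ?thesis using that[of x y z] that[of x z y] D(1) by (auto simp: insert_commute)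
qed

text \<open>Another common vertex would give a digon, a transitive triangle, or an in-neighbourhood
  equal to an out-neighbourhood.\<close>

lemma fan_in_out:
  assumes o: "fan E w Y" and i: "fan (E\<inverse>) w Z"
  shows "Y \<inter> Z = {w}"
proof -
  obtain u u' a b where f: "fan4 E w u u' a b" and Y: "Y = {w, u, u', a, b}"
    using o by (auto simp: fan_def)
  obtain t t' c d where g: "fan4 (E\<inverse>) w t t' c d" and Z: "Z = {w, t, t', c, d}"
    using i by (auto simp: fan_def)
  note d = fan4D[OF f] and e = fan4D[OF g, simplified]
  have disj: "u \<noteq> t \<and> u \<noteq> c \<and> a \<noteq> t \<and> a \<noteq> c"
    if u: "(w, u) \<in> E" "(a, u) \<in> E" "E\<inverse> `` {u} = {w, a}" and t: "(t, w) \<in> E" "(t, c) \<in> E" "E `` {t} = {w, c}" for u a t c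
  proof (intro conjI notI)
    show False if "u = t" using u(1) t(1) asym that by blast
    show False if "u = c" using no_transitive[OF t(1) u(1)] t(2) that by blast
    show False if "a = t" using no_transitive[OF t(1) u(1)] u(2) that by blast
    show False if "a = c" using no_twins(2)[of u t] inV(2)[OF u(1)] inV(1)[OF t(1)] u(3) t(3) that by simp
  qed
  have "{u, u', a, b} \<inter> {t, t', c, d} = {}"
    using disj[OF d(1,3,10) e(1,3)] disj[OF d(1,3,10) e(2,4)] disj[OF d(2,4,11) e(1,3)] disj[OF d(2,4,11) e(2,4)]
      e(10,11) by auto
  moreover have "w \<notin> {u, u', a, b}" "w \<notin> {t, t', c, d}" using d(8) e(8) by auto
  ultimately show ?thesis using Y Z by blast
qed

section \<open>The extremal choice of a fan and a component\<close>

definition fams :: "'a set set" where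
  "fams = {Y. \<exists>v\<in>V. fan E v Y \<or> fan (E\<inverse>) v Y}"

lemma fams_facts:
  assumes "Y \<in> fams"
  shows "Y \<subseteq> V" "card Y = 5" "tau E V \<le> 3 + tau E (V - Y)" "wt E Y = 9" "btw E Y (V - Y) = 12"
proof -
  interpret d: mincex "E\<inverse>" V by (rule dual)
  from assms obtain v where "fan E v Y \<or> fan (E\<inverse>) v Y" by (auto simp: fams_def)
  then have *: "Y \<subseteq> V \<and> card Y = 5 \<and> tau E V \<le> 3 + tau E (V - Y) \<and> wt E Y = 9 \<and> btw E Y (V - Y) = 12"
  proof
    assume "fan E v Y"
    from fan_facts[OF this] show ?thesis by simp
  next
    assume "fan (E\<inverse>) v Y"
    from d.fan_facts[OF this] show ?thesis
      using finV by (simp add: tau_converse wt_converse btw_converse)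
  qed
  then show "Y \<subseteq> V" "card Y = 5" "tau E V \<le> 3 + tau E (V - Y)" "wt E Y = 9" "btw E Y (V - Y) = 12"
    by blast+
qed

lemma no_minimal_counterexample: False
proof -
  interpret d: mincex "E\<inverse>" V by (rule dual)
  define P where "P p \<longleftrightarrow> fst p \<in> fams \<and> snd p \<in> comps E (V - fst p)" for p :: "'a set \<times> 'a set"
  have bad2: "2 \<le> card (bad Y)" and bad4: "C \<in> bad Y \<Longrightarrow> 4 \<le> btw E C Y" and bad1: "C \<in> bad Y \<Longrightarrow> exc E C = 1"
    if "Y \<in> fams" for Y C
    using bad_comps[of Y 3] fams_facts[OF that] by simp_all
  have exP: "\<exists>p. P p"
  proof -
    obtain v where v: "v \<in> V" using connV by (auto simp: conn_def)
    then obtain Y where Y: "fan E v Y" by (rule fan_exists)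
    then have "Y \<in> fams" using v by (auto simp: fams_def)
    moreover then have "bad Y \<noteq> {}" using bad2 by force
    then obtain C where "C \<in> comps E (V - Y)" by (auto simp: bad_def)
    ultimately show ?thesis unfolding P_def by (intro exI[of _ "(Y, C)"]) simp
  qed
  have "\<forall>p. P p \<longrightarrow> card (snd p) < Suc (card V)"
    using compsD(1) finV by (auto simp: P_def less_Suc_eq_le intro!: card_mono)
  then obtain p where p: "P p" and pmax: "\<And>r. P r \<Longrightarrow> card (snd r) \<le> card (snd p)"
    using exP ex_has_greatest_nat[of P _ "\<lambda>p. card (snd p)" "Suc (card V)"] by blast
  define Y K where "Y = fst p" and "K = snd p"
  have Y: "Y \<in> fams" and K: "K \<in> comps E (V - Y)" using p by (auto simp: P_def Y_def K_def)
  have Kmax: "card C \<le> card K" if "Z \<in> fams" "C \<in> comps E (V - Z)" for Z C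
    using pmax[of "(Z, C)"] that by (simp add: P_def K_def)
  note Yf = fams_facts[OF Y] and Kc = compsD[OF K]
  define A where "A = nbd E K"
  have AV: "A \<subseteq> V" using EV by (auto simp: A_def nbd_def)
  \<comment> \<open>\<open>K\<close> survives inside a component of \<open>V - Z\<close>, and by
    maximality it is that component. Hence all its neighbours lie in \<open>Z\<close>.\<close>
  have key: "A \<subseteq> Z" if Z: "Z \<in> fams" "Z \<inter> K = {}" for Z
  proof -
    have KZ: "K \<subseteq> V - Z" using Kc(1) Z(2) by blast
    obtain C where C: "C \<in> comps E (V - Z)" "K \<subseteq> C"
      using comps_super[OF _ Kc(2) KZ] finV by blast
    have "finite C" using compsD(1)[OF C(1)] finV by (meson finite_Diff finite_subset)
    then have "K = C" using card_seteq[of C K] Kmax[OF Z(1) C(1)] C(2) by blast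
    then show ?thesis using compsD(3)[OF C(1)] AV unfolding A_def nbd_def by blast
  qed
  have AY: "A \<subseteq> Y" by (rule key[OF Y]) (use Kc(1) in blast)
  have Y0: "Y \<noteq> {}" using Yf(2) by auto
  have A0: "A \<noteq> {}"
    using comps_attached(3)[OF finV connV Yf(1) Y0 K] Kc(1) unfolding A_def nbd_def by blast
  have fb: "finite (bad Y)" using finite_comps[of "V - Y" E] finV by (simp add: bad_def)
  obtain D where D: "D \<in> bad Y" "D \<noteq> K"
  proof -
    have "\<not> bad Y \<subseteq> {K}" using bad2[OF Y] card_mono[of "{K}" "bad Y"] by auto
    then show ?thesis using that by blast
  qed
  have Dc: "D \<in> comps E (V - Y)" using D by (simp add: bad_def)
  note Dd = compsD[OF Dc]
  have DK: "D \<inter> K = {}" by (rule comps_disjoint[OF Dc K D(2)])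
  have finD: "finite D" and finY: "finite Y" using Dd(1) finV Yf(1) by (meson finite_Diff finite_subset)+
  define q where "q = btw E D Y"
  have q4: "4 \<le> q" using bad4[OF Y D(1)] by (simp add: q_def)
  \<comment> \<open>A second bad component takes at least four of the twelve boundary arcs.\<close>
  have q8: "q \<le> 8"
  proof -
    have "\<not> bad Y \<subseteq> {D}" using bad2[OF Y] card_mono[of "{D}" "bad Y"] by auto
    then obtain D' where D': "D' \<in> bad Y" "D' \<noteq> D" by blast
    have "btw E D Y + btw E D' Y = (\<Sum>C\<in>{D, D'}. btw E C Y)" using D' by simp
    also have "\<dots> \<le> (\<Sum>C\<in>bad Y. btw E C Y)"
      by (rule sum_mono2) (use fb D D' btw_nonneg in auto)
    also have "\<dots> \<le> 12" using sum_bad_le[OF Yf(1)] Yf(5) by simp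
    finally show ?thesis using bad4[OF Y D'(1)] by (simp add: q_def)
  qed
  have esc: "A \<subseteq> Z" if w: "w \<in> D" and F: "F = E \<or> F = E\<inverse>" "fan F w Z" "\<And>u. (w, u) \<in> F \<Longrightarrow> u \<notin> A" for w F Z
  proof (rule key)
    show "Z \<in> fams" using F w Dd(1) by (auto simp: fams_def)
    show "Z \<inter> K = {}"
      by (rule fan_avoids[OF F(2,1)]) (use w DK AY Dd(1) F(3) in \<open>auto simp: A_def\<close>)
  qed
  \<comment> \<open>Otherwise both the out-fan and the in-fan of \<open>w\<close> avoid
    \<open>K\<close> and so contain \<open>A\<close>, but they share only \<open>w\<close>.\<close>
  have nbr: "\<exists>y\<in>A. (w, y) \<in> E \<or> (y, w) \<in> E" if w: "w \<in> D" for w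
  proof (rule ccontr)
    assume no: "\<not> ?thesis"
    have wV: "w \<in> V" using w Dd(1) by blast
    obtain Z1 where Z1: "fan E w Z1" using fan_exists[OF wV] .
    obtain Z2 where Z2: "fan (E\<inverse>) w Z2" using d.fan_exists[OF wV] .
    have "A \<subseteq> Z1" by (rule esc[OF w _ Z1]) (use no in auto)
    moreover have "A \<subseteq> Z2" by (rule esc[OF w _ Z2]) (use no in auto)
    ultimately have "A \<subseteq> {w}" using fan_in_out[OF Z1 Z2] by blast
    then show False using A0 AY w Dd(1) by auto
  qed
  have finA: "finite A" using AY finY by (rule finite_subset)
  have wA: "1 \<le> btw E {w} A" if "w \<in> D" for w
    using nbr[OF that] btw_pos[of "{w}" A w _ E] finA by auto
  have wY: "btw E {w} A \<le> btw E {w} Y" for w by (rule btw_mono) (use finY AY in auto)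
  have DA: "int (card D) \<le> btw E D A"
  proof -
    have "(\<Sum>w\<in>D. 1) \<le> (\<Sum>w\<in>D. btw E {w} A)" by (rule sum_mono) (rule wA)
    then show ?thesis using btw_sum_left[OF finD finA, of E] by simp
  qed
  have DAY: "btw E D A \<le> q" unfolding q_def by (rule btw_mono) (use finY finD AY in auto)
  have "(\<Sum>w\<in>D. int (deg E w)) = (\<Sum>w\<in>D. 4)" by (rule sum.cong) (use Dd(1) regular_4(1) in auto)
  moreover have "btw E D (V - D) = q"
    using comps_attached(2)[OF finV connV Yf(1) Y0 Dc] by (simp add: q_def)
  moreover have "D \<subseteq> V" using Dd(1) by blast
  ultimately have hs: "4 * int (card D) = 2 * int (card (ind E D)) + q"
    using handshake[OF finV EV, of D] by simp
  have ex: "7 * int (tau E D) = int (card D) + int (card (ind E D)) + 1"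
    using bad1[OF Y D(1)] by (simp add: exc_def wt_def)
  have D0: "card D \<ge> 1" using Dd(2) finD by (simp add: conn_def Suc_le_eq card_gt_0_iff)
  have "card D = 3 \<and> card (ind E D) = 3 \<or> card D = 8 \<and> q = 8"
  proof -
    \<comment> \<open>Eliminating e gives 7 t = 3 n - q / 2 + 1 with q in {4, 6, 8}, so n is 5, 3 or
      1 modulo 7 respectively. By n \<le> q and e \<ge> 0 only n = e = 3 and n = q = 8
      survive.\<close>
    have arith: "n = 3 \<and> e = 3 \<or> n = 8 \<and> q = 8"
      if "4 * n = 2 * e + q" "7 * t = n + e + 1" "1 \<le> n" "n \<le> q" "0 \<le> e" for n e t :: int
    proof -
      have "n = 1 \<or> n = 2 \<or> n = 3 \<or> n = 4 \<or> n = 5 \<or> n = 6 \<or> n = 7 \<or> n = 8" using that(3,4) q8 by arith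
      then show ?thesis using that(1,2,4,5) q4 q8 by (elim disjE; hypsubst; presburger)
    qed
    have "1 \<le> int (card D)" "int (card D) \<le> q" using D0 DA DAY by linarith+
    from arith[OF hs ex this] show ?thesis by simp
  qed
  then show False
  proof
    assume 3: "card D = 3 \<and> card (ind E D) = 3"
    obtain x y z where xyz: "D = {x, y, z}" "(x, y) \<in> E" "(y, z) \<in> E" "(z, x) \<in> E"
      using three_cycle[of D] 3 Dd(1) by blast
    from Y obtain v where "fan E v Y \<or> fan (E\<inverse>) v Y" by (auto simp: fams_def)
    then show False
    proof
      assume "fan E v Y"
      from fan_no_triangle[OF this Dc xyz] show False .
    next
      assume fan: "fan (E\<inverse>) v Y"
      show False
        by (rule d.fan_no_triangle[OF fan, of D x z y]) (use Dc xyz in \<open>auto simp: comps_converse\<close>)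
    qed
  next
    assume 8: "card D = 8 \<and> q = 8"
    have sumY: "(\<Sum>w\<in>D. btw E {w} Y) = 8" using btw_sum_left[OF finD finY, of E] 8 by (simp add: q_def)
    \<comment> \<open>Eight vertices, each with an arc to \<open>A\<close>, share just eight arcs to
      \<open>Y\<close>.\<close>
    have one: "btw E {w} Y = 1" if w: "w \<in> D" for w
    proof -
      have "(\<Sum>x\<in>D - {w}. 1) \<le> (\<Sum>x\<in>D - {w}. btw E {x} Y)"
        by (rule sum_mono) (use wA wY order_trans in blast)
      moreover have "(\<Sum>x\<in>D. btw E {x} Y) = btw E {w} Y + (\<Sum>x\<in>D - {w}. btw E {x} Y)"
        using finD w by (rule sum.remove)
      ultimately have "btw E {w} Y \<le> 1" using sumY 8 w finD by simp
      then show ?thesis using wA[OF w] wY[of w] by linarith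
    qed
    have uniq: "y = y'" if "w \<in> D" "y \<in> Y" "y' \<in> Y" "(w, y) \<in> E \<or> (y, w) \<in> E" "(w, y') \<in> E \<or> (y', w) \<in> E" for w y y'
    proof (rule ccontr)
      assume "y \<noteq> y'"
      then have "btw E {w} {y, y'} = 2"
        using btw_insert3(2)[of "{w}" w y y'] that Dd(1) by (auto simp: btw_single)
      moreover have "btw E {w} {y, y'} \<le> btw E {w} Y" by (rule btw_mono) (use finY that in auto)
      ultimately show False using one[OF that(1)] by simp
    qed
    obtain w where w: "w \<in> D" using Dd(2) by (auto simp: conn_def)
    have wV: "w \<in> V" using w Dd(1) by blast
    obtain \<alpha> where al: "\<alpha> \<in> A" "(w, \<alpha>) \<in> E \<or> (\<alpha>, w) \<in> E" using nbr[OF w] by blast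
    \<comment> \<open>The only arc between \<open>w\<close> and \<open>Y\<close> has one direction;
      the fan taken in the other direction has no member of \<open>A\<close> next to its
      centre.\<close>
    have small: "\<exists>F Z. (F = E \<or> F = E\<inverse>) \<and> fan F w Z \<and> (\<forall>u. (w, u) \<in> F \<longrightarrow> u \<notin> A)"
    proof (cases "(\<alpha>, w) \<in> E")
      case True
      obtain Z where Z: "fan E w Z" using fan_exists[OF wV] .
      have "u \<notin> A" if "(w, u) \<in> E" for u
        using uniq[OF w, of \<alpha> u] al True that AY asym[OF that] by blast
      then show ?thesis using Z by blast
    next
      case False
      then have wa: "(w, \<alpha>) \<in> E" using al by blast
      obtain Z where Z: "fan (E\<inverse>) w Z" using d.fan_exists[OF wV] .
      have "u \<notin> A" if "(w, u) \<in> E\<inverse>" for u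
        using uniq[OF w, of \<alpha> u] wa al(1) that AY asym[OF wa] by blast
      then show ?thesis using Z by blast
    qed
    then obtain F Z where F: "F = E \<or> F = E\<inverse>" "fan F w Z" and Fu: "\<And>u. (w, u) \<in> F \<Longrightarrow> u \<notin> A" by blast
    have AZ: "A \<subseteq> Z" by (rule esc[OF w F Fu])
    obtain u u' a b where f: "fan4 F w u u' a b" and Z: "Z = {w, u, u', a, b}"
      using F(2) by (auto simp: fan_def)
    have "u \<notin> A" "u' \<notin> A" "w \<notin> A" using Fu fan4D(1,2)[OF f] AY w Dd(1) by auto
    then have "A \<subseteq> {a, b}" using AZ Z by blast
    then have "card A \<le> card {a, b}" by (intro card_mono) auto
    also have "\<dots> \<le> 2" by (simp add: card_insert_if)
    finally have A2: "card A \<le> 2" .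
    \<comment> \<open>At most two vertices of degree 4 have at most eight arcs leaving
      \<open>A\<close>; \<open>D\<close> uses eight and \<open>K\<close> needs one more.\<close>
    have "(\<Sum>y\<in>A. int (deg E y)) = (\<Sum>y\<in>A. 4)" by (rule sum.cong) (use AV regular_4(1) in auto)
    then have "btw E A (V - A) \<le> 8" using handshake[OF finV EV AV] A2 by simp
    moreover have "btw E A (D \<union> K) \<le> btw E A (V - A)"
      by (rule btw_mono) (use finA finV AY Dd(1) Kc(1) in auto)
    moreover have finK: "finite K" using Kc(1) finV by (meson finite_Diff finite_subset)
    have "btw E A (D \<union> K) = btw E A D + btw E A K"
      by (rule btw_Un_right) (use finA finD finK DK in auto)
    moreover obtain \<beta> where "\<beta> \<in> A" using A0 by blast
    then have "1 \<le> btw E A K" using btw_pos[OF finA finK, of \<beta> _ E] unfolding A_def nbd_def by blast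
    moreover have "8 \<le> btw E A D" using DA 8 by (simp add: btw_commute)
    ultimately show False by linarith
  qed
qed

end

theorem exc_le_1:
  assumes "finite W" "\<And>x y. (x, y) \<in> E \<Longrightarrow> (y, x) \<notin> E" "conn E W"
  shows "exc E W \<le> 1"
  using assms
proof (induction "card W" arbitrary: E W rule: less_induct)
  case less
  show ?case
  proof (rule ccontr)
    assume neg: "\<not> exc E W \<le> 1"
      \<comment> \<open>\<open>mincex\<close> wants all arcs inside the vertex set, so
        \<open>E\<close> is first restricted to \<open>W\<close>.\<close>
      have "tau (ind E W) W = tau E W"
      by (rule antisym) (rule tau_subset[OF less.prems(1)], auto simp: ind_def)+
    moreover have "ind (ind E W) W = ind E W" by (auto simp: ind_def)
    ultimately have "exc (ind E W) W = exc E W" by (simp add: exc_def wt_def)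
    then have "mincex (ind E W) W"
      using less neg by unfold_locales (auto simp: ind_def intro: conn_subrel)
    then show False by (rule mincex.no_minimal_counterexample)
  qed
qed

subsection \<open>Six-regular graphs\<close>

locale six_regular =
  fixes E :: "('a \<times> 'a) set" and V :: "'a set"
  assumes finV: "finite V" and EV: "E \<subseteq> V \<times> V" and asym: "\<And>x y. (x, y) \<in> E \<Longrightarrow> (y, x) \<notin> E"
    and connV: "conn E V" and deg6: "\<And>v. v \<in> V \<Longrightarrow> deg E v = 6" and excV: "exc E V = 1"
begin

definition star :: "'a \<Rightarrow> 'a set \<Rightarrow> bool" where
  "star v N \<longleftrightarrow> v \<in> V \<and> (N = E `` {v} \<or> N = E\<inverse> `` {v}) \<and> card N \<le> 3"

definition heavy :: "'a set \<Rightarrow> 'a set set" where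
  "heavy Y = {C \<in> comps E (V - Y). exc E C = 1}"

lemma star_exists: assumes "v \<in> V" obtains N where "star v N"
proof -
  have "card (E `` {v}) \<le> 3 \<or> card (E\<inverse> `` {v}) \<le> 3"
    using deg6[OF assms] by (auto simp: deg_def)
  then show ?thesis using that assms unfolding star_def by blast
qed

lemma starD:
  assumes "star v N"
  shows "insert v N \<subseteq> V" "v \<notin> N" "u \<in> N \<Longrightarrow> (v, u) \<in> E \<or> (u, v) \<in> E"
    "N = E `` {v} \<or> N = E\<inverse> `` {v}"
  using assms EV asym unfolding star_def by auto

text \<open>The star goes at cost d = \<open>card N\<close>. Its size cancels: 1 + 7 (d + 1) - e - 7
  d = 8 - e, where e counts the inner arcs, at most 6 for d \<le> 3 and at most 3 for d \<le>
  2.\<close>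

lemma star_heavy:
  assumes st: "star v N"
  shows "2 \<le> card (heavy (insert v N))" and "card N \<le> 2 \<Longrightarrow> 5 \<le> card (heavy (insert v N))"
proof -
  note d = starD[OF st]
  define Y where "Y = insert v N"
  have YV: "Y \<subseteq> V" "Y \<noteq> {}" using d(1) by (auto simp: Y_def)
  have finY: "finite Y" using YV(1) finV by (rule finite_subset)
  then have cY: "card Y = Suc (card N)" using d(2) by (simp add: Y_def)
  have "tau E (V - N) \<le> tau E (V - N - {v})"
    using d(4)
  proof
    assume "N = E `` {v}"
    then show ?thesis by (intro tau_sink) (use finV in auto)
  next
    assume "N = E\<inverse> `` {v}"
    then show ?thesis by (intro tau_source) (use finV in auto)
  qed
  moreover have "V - N - {v} = V - Y" by (auto simp: Y_def)
  moreover have "tau E V \<le> card N + tau E (V - N)" using tau_delete[of V N E] finV d(1) by auto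
  ultimately have k: "tau E V \<le> card N + tau E (V - Y)" by simp
  have "(\<Sum>y\<in>Y. int (deg E y)) = (\<Sum>y\<in>Y. 6)" by (rule sum.cong) (use YV deg6 in auto)
  then have "btw E Y (V - Y) = 6 * int (card Y) - 2 * int (card (ind E Y))"
    using handshake[OF finV EV YV(1)] by simp
  then have ge: "8 - int (card (ind E Y)) \<le> (\<Sum>C\<in>comps E (V - Y). exc E C)"
    using exc_delete[OF finV YV(1) k] excV cY by (simp add: wt_def)
  have fc: "finite (comps E (V - Y))" using finV finite_comps by blast
  have "(\<Sum>C\<in>comps E (V - Y). exc E C) \<le> (\<Sum>C\<in>comps E (V - Y). if C \<in> heavy Y then 1 else 0)"
  proof (rule sum_mono)
    fix C assume C: "C \<in> comps E (V - Y)"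
    have "finite C" using compsD(1)[OF C] finV by (meson finite_Diff finite_subset)
    then have "exc E C \<le> 1" using exc_le_1[of C E] asym compsD(2)[OF C] by blast
    then show "exc E C \<le> (if C \<in> heavy Y then 1 else 0)" using C by (auto simp: heavy_def)
  qed
  also have "\<dots> = int (card (comps E (V - Y) \<inter> heavy Y))" using fc by (simp add: sum.If_cases)
  also have "comps E (V - Y) \<inter> heavy Y = heavy Y" by (auto simp: heavy_def)
  finally have h: "8 \<le> card (heavy Y) + card (ind E Y)" using ge by linarith
  have e: "2 * card (ind E Y) \<le> Suc (card N) * card N"
    using card_ind_le[OF finY asym] cY by simp
  have "card N \<le> 3" using st by (simp add: star_def)
  then have "Suc (card N) * card N \<le> 4 * 3" by (intro mult_le_mono) auto
  then show "2 \<le> card (heavy (insert v N))" using h e by (simp add: Y_def)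
  assume "card N \<le> 2"
  then have "Suc (card N) * card N \<le> 3 * 2" by (intro mult_le_mono) auto
  then show "5 \<le> card (heavy (insert v N))" using h e by (simp add: Y_def)
qed

lemma exc_singleton: "exc E {v} \<le> 0"
proof -
  have "ind E {v} = {}" "acyc E {v}" using asym by (auto simp: ind_def acyc_def)
  then show ?thesis by (simp add: exc_def wt_def tau_acyc)
qed

lemma no_extremal_six_regular: False
proof -
  define P where "P p \<longleftrightarrow> (\<exists>v N. star v N \<and> fst p = insert v N) \<and> snd p \<in> comps E (V - fst p)"
    for p :: "'a set \<times> 'a set"
  have exP: "\<exists>p. P p"
  proof -
    obtain v where v: "v \<in> V" using connV by (auto simp: conn_def)
    then obtain N where N: "star v N" by (rule star_exists)
    then have "heavy (insert v N) \<noteq> {}" using star_heavy(1)[OF N] by force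
    then obtain C where "C \<in> comps E (V - insert v N)" by (auto simp: heavy_def)
    then show ?thesis unfolding P_def using N by (intro exI[of _ "(insert v N, C)"]) auto
  qed
  have "\<forall>p. P p \<longrightarrow> card (snd p) < Suc (card V)"
    using compsD(1) finV by (auto simp: P_def less_Suc_eq_le intro!: card_mono)
  then obtain p where p: "P p" and pmax: "\<And>r. P r \<Longrightarrow> card (snd r) \<le> card (snd p)"
    using exP ex_has_greatest_nat[of P _ "\<lambda>p. card (snd p)" "Suc (card V)"] by blast
  define K where "K = snd p"
  obtain v0 N0 where st0: "star v0 N0" and K0: "K \<in> comps E (V - insert v0 N0)"
    using p by (auto simp: P_def K_def)
  have Kmax: "card C \<le> card K" if "star v N" "C \<in> comps E (V - insert v N)" for v N C
    using pmax[of "(insert v N, C)"] that by (auto simp: P_def K_def)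
  note Kc = compsD[OF K0]
  define A where "A = nbd E K"
  have AV: "A \<subseteq> V" using EV by (auto simp: A_def nbd_def)
  have keyK: "K \<in> comps E (V - insert v N)" if st: "star v N" and dis: "insert v N \<inter> K = {}" for v N
  proof -
    have KZ: "K \<subseteq> V - insert v N" using Kc(1) dis by blast
    obtain C where C: "C \<in> comps E (V - insert v N)" "K \<subseteq> C"
      using comps_super[OF _ Kc(2) KZ] finV by blast
    have "finite C" using compsD(1)[OF C(1)] finV by (meson finite_Diff finite_subset)
    then have "K = C" using card_seteq[of C K] Kmax[OF st C(1)] C(2) by blast
    then show ?thesis using C(1) by simp
  qed
  have AY: "A \<subseteq> insert v N" if "K \<in> comps E (V - insert v N)" for v N
    using compsD(3)[OF that] AV unfolding A_def nbd_def by blast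
  have A0: "A \<noteq> {}"
  proof -
    have "\<exists>x\<in>K. \<exists>y\<in>insert v0 N0. (x, y) \<in> E \<or> (y, x) \<in> E"
      by (rule comps_attached(3)[OF finV connV _ _ K0]) (use starD(1)[OF st0] in auto)
    then show ?thesis using Kc(1) unfolding A_def nbd_def by blast
  qed
  \<comment> \<open>\<open>w\<close> is neither in \<open>K\<close> nor adjacent to it, so every
    star at \<open>w\<close> misses \<open>K\<close>, and maximality makes \<open>K\<close> a
    component again. Returning this fact allows the argument to restart from the new star.\<close>
  have near: "star w M \<Longrightarrow> A \<subseteq> M \<and> K \<in> comps E (V - insert w M)"
    if st: "star v N" "K \<in> comps E (V - insert v N)" and D: "D \<in> heavy (insert v N)" "D \<noteq> K" and w: "w \<in> D"
    for v N D w M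
  proof -
    assume M: "star w M"
    have Dc: "D \<in> comps E (V - insert v N)" using D by (simp add: heavy_def)
    have wn: "w \<notin> K" using comps_disjoint[OF Dc st(2) D(2)] w by blast
    have wA: "w \<notin> A" using AY[OF st(2)] compsD(1)[OF Dc] w by blast
    have "u \<notin> K" if "u \<in> M" for u
      using starD(3)[OF M that] wn wA unfolding A_def nbd_def by blast
    then have KM: "K \<in> comps E (V - insert w M)" by (intro keyK[OF M]) (use wn in auto)
    then show ?thesis using AY[OF KM] wA by blast
  qed
  \<comment> \<open>Otherwise both neighbourhoods of \<open>w\<close> have three vertices and both
    give stars, so \<open>A\<close> would lie in both, against asymmetry.\<close>
  have small: "\<exists>M. star w M \<and> card M \<le> 2"
    if st: "star v N" "K \<in> comps E (V - insert v N)" and D: "D \<in> heavy (insert v N)" "D \<noteq> K" and w: "w \<in> D"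
    for v N D w
  proof (rule ccontr)
    assume no: "\<not> ?thesis"
    have wV: "w \<in> V" using D w compsD(1) by (auto simp: heavy_def)
    have imp: "\<not> card M \<le> 2" if "M = E `` {w} \<or> M = E\<inverse> `` {w}" for M
    proof
      assume "card M \<le> 2"
      then have "star w M" using that wV by (simp add: star_def)
      then show False using no \<open>card M \<le> 2\<close> by blast
    qed
    have "\<not> card (E `` {w}) \<le> 2" "\<not> card (E\<inverse> `` {w}) \<le> 2"
      by (rule imp; simp)+
    then have "card (E `` {w}) = 3" "card (E\<inverse> `` {w}) = 3" using deg6[OF wV] by (auto simp: deg_def)
    then have "star w (E `` {w})" "star w (E\<inverse> `` {w})" using wV by (auto simp: star_def)
    then have "A \<subseteq> E `` {w}" "A \<subseteq> E\<inverse> `` {w}" using near[OF st D w] by blast+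
    then show False using A0 asym by blast
  qed
  obtain D where D: "D \<in> heavy (insert v0 N0)" "D \<noteq> K"
  proof -
    have "\<not> heavy (insert v0 N0) \<subseteq> {K}"
      using star_heavy(1)[OF st0] card_mono[of "{K}" "heavy (insert v0 N0)"] by auto
    then show ?thesis using that by blast
  qed
  have "D \<in> comps E (V - insert v0 N0)" using D(1) by (simp add: heavy_def)
  from conn_nonempty[OF compsD(2)[OF this]] obtain w where w: "w \<in> D" by blast
  obtain M where M: "star w M" "card M \<le> 2" using small[OF st0 K0 D w] by blast
  have KM: "K \<in> comps E (V - insert w M)" using near[OF st0 K0 D w M(1)] by blast
  define B where "B = heavy (insert w M) - {K}"
  have "finite (comps E (V - insert w M))" using finV finite_comps by blast
  then have fH: "finite (heavy (insert w M))" by (simp add: heavy_def)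
  \<comment> \<open>Restarting from a star with at most two leaves gives four heavy components
    besides \<open>K\<close>. Each has at least two vertices, and all these are adjacent to one
    \<open>a\<close> in \<open>A\<close>, which has degree 6.\<close>
  have "5 \<le> card (heavy (insert w M))" by (rule star_heavy(2)[OF M])
  then have B4: "4 \<le> card B" using card_Diff1_le[of "heavy (insert w M)" K] fH
    by (simp add: B_def card_Diff_singleton_if split: if_splits)
  have Bc: "C \<in> comps E (V - insert w M)" "exc E C = 1" if "C \<in> B" for C
    using that by (auto simp: B_def heavy_def)
  have finC: "finite C" if "C \<in> B" for C
    using compsD(1)[OF Bc(1)[OF that]] finV by (meson finite_Diff finite_subset)
  have C2: "2 \<le> card C" if C: "C \<in> B" for C
  proof (rule ccontr)
    assume "\<not> ?thesis"
    moreover have "C \<noteq> {}" using compsD(2)[OF Bc(1)[OF C]] by (simp add: conn_def)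
    then have "card C \<noteq> 0" using finC[OF C] by simp
    ultimately have "card C = 1" by simp
    then obtain x where "C = {x}" by (rule card_1_singletonE)
    then show False using exc_singleton[of x] Bc(2)[OF C] by simp
  qed
  obtain a where a: "a \<in> A" using A0 by blast
  have "\<Union>B \<subseteq> E `` {a} \<union> E\<inverse> `` {a}"
  proof
    fix x assume "x \<in> \<Union>B"
    then obtain C where C: "C \<in> B" "x \<in> C" by blast
    have H: "C \<in> heavy (insert w M)" "C \<noteq> K" using C(1) by (auto simp: B_def)
    obtain M' where M': "star x M'" using small[OF M(1) KM H C(2)] by blast
    then have "a \<in> M'" using near[OF M(1) KM H C(2) M'] a by blast
    then show "x \<in> E `` {a} \<union> E\<inverse> `` {a}" using starD(3)[OF M'] by auto
  qed
  moreover have "finite (E `` {a} \<union> E\<inverse> `` {a})" by (rule finite_subset[OF _ finV]) (use EV in auto)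
  ultimately have "card (\<Union>B) \<le> card (E `` {a} \<union> E\<inverse> `` {a})" by (intro card_mono)
  also have "\<dots> \<le> deg E a" unfolding deg_def by (rule card_Un_le)
  also have "\<dots> = 6" using deg6 a AV by blast
  finally have "card (\<Union>B) \<le> 6" .
  moreover have "card (\<Union>B) = (\<Sum>C\<in>B. card C)"
  proof (rule card_Union_disjoint[OF _ finC])
    show "pairwise disjnt B"
      unfolding pairwise_def disjnt_def using comps_disjoint[OF Bc(1) Bc(1)] by blast
  qed
  moreover have "(\<Sum>C\<in>B. 2) \<le> (\<Sum>C\<in>B. card C)" by (rule sum_mono) (rule C2)
  ultimately show False using B4 by simp
qed

end

section \<open>Maximum degree six, first connected and then arbitrary\<close>

lemma tau_le_conn:
  assumes fin: "finite V" and EV: "E \<subseteq> V \<times> V" and asym: "\<And>x y. (x, y) \<in> E \<Longrightarrow> (y, x) \<notin> E"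
    and conn: "conn E V" and deg: "\<And>v. v \<in> V \<Longrightarrow> deg E v \<le> 6"
  shows "7 * tau E V \<le> 4 * card V"
proof -
  have exc: "exc E V \<le> 1" by (rule exc_le_1[OF fin _ conn]) (use asym in blast)
  have hs: "(\<Sum>v\<in>V. int (deg E v)) = 2 * int (card (ind E V))"
    using handshake[OF fin EV, of V] by simp
  show ?thesis
  proof (cases "\<forall>v\<in>V. deg E v = 6")
    case True
    have "exc E V \<noteq> 1"
    proof
      assume "exc E V = 1"
      then have "six_regular E V" using assms True by unfold_locales auto
      then show False by (rule six_regular.no_extremal_six_regular)
    qed
    moreover have "(\<Sum>v\<in>V. int (deg E v)) = (\<Sum>v\<in>V. 6)" by (rule sum.cong) (use True in auto)
    ultimately show ?thesis using exc hs by (simp add: exc_def wt_def)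
  next
    case False
    then obtain v where v: "v \<in> V" "deg E v < 6" using deg by force
    have "(\<Sum>v\<in>V. int (deg E v)) < (\<Sum>v\<in>V. 6)"
      by (rule sum_strict_mono_ex1) (use fin deg v in auto)
    then show ?thesis using exc hs by (simp add: exc_def wt_def)
  qed
qed

theorem tau_le_deg_6:
  assumes fin: "finite V" and EV: "E \<subseteq> V \<times> V" and asym: "\<And>x y. (x, y) \<in> E \<Longrightarrow> (y, x) \<notin> E"
    and deg: "\<And>v. v \<in> V \<Longrightarrow> deg E v \<le> 6"
  shows "7 * tau E V \<le> 4 * card V"
proof -
  define f where "f W = 7 * int (tau E W) - 4 * int (card W)" for W
  have "f V \<le> (\<Sum>C\<in>comps E V. f C)"
  proof (rule comps_sum[OF fin])
    show "f {} = 0" by (simp add: f_def tau_acyc acyc_def)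
    fix A B assume AB: "A \<subseteq> V" "B \<subseteq> V" "A \<inter> B = {}"
      and no: "\<And>x y. x \<in> A \<Longrightarrow> y \<in> B \<Longrightarrow> (x, y) \<notin> E \<and> (y, x) \<notin> E"
    have f: "finite A" "finite B" using AB fin by (auto intro: finite_subset)
    have "tau E (A \<union> B) \<le> tau E A + tau E B"
      by (rule tau_Un_oneway[OF f AB(3)]) (use no in blast)
    then show "f (A \<union> B) \<le> f A + f B" using f AB(3) by (simp add: f_def card_Un_disjoint)
  qed
  also have "\<dots> \<le> (\<Sum>C\<in>comps E V. 0)"
  proof (rule sum_mono)
    fix C assume C: "C \<in> comps E V"
    note Cc = compsD[OF C]
    have finC: "finite C" using Cc(1) fin by (rule finite_subset)
    have "7 * tau (ind E C) C \<le> 4 * card C"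
    proof (rule tau_le_conn[OF finC])
      show "ind E C \<subseteq> C \<times> C" by (auto simp: ind_def)
      show "(y, x) \<notin> ind E C" if "(x, y) \<in> ind E C" for x y using asym[of x y] that by (auto simp: ind_def)
      show "conn (ind E C) C" by (rule conn_subrel[OF Cc(2)]) (auto simp: ind_def)
      fix v assume "v \<in> C"
      have "card (ind E C `` {v}) \<le> card (E `` {v})" "card ((ind E C)\<inverse> `` {v}) \<le> card (E\<inverse> `` {v})"
        by (rule card_mono; use EV in \<open>auto simp: ind_def intro: finite_subset[OF _ fin]\<close>)+
      then show "deg (ind E C) v \<le> 6" using deg[of v] Cc(1) \<open>v \<in> C\<close> by (auto simp: deg_def)
    qed
    moreover have "tau E C \<le> tau (ind E C) C" by (rule tau_subset[OF finC]) (auto simp: ind_def)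
    ultimately show "f C \<le> 0" by (simp add: f_def)
  qed
  finally show ?thesis by (simp add: f_def)
qed

subsection \<open>Digraphs\<close>

text \<open>For a closed walk the conclusion would put a rank below itself, so a rank function rules
  out cycles.\<close>

lemma (in pre_digraph) rank_awalk:
  fixes f :: "'a \<Rightarrow> nat"
  assumes "\<And>e. e \<in> arcs G \<Longrightarrow> f (tail G e) < f (head G e)"
  shows "cas u p v \<Longrightarrow> set p \<subseteq> arcs G \<Longrightarrow> p \<noteq> [] \<Longrightarrow> f u < f v"
proof (induction p arbitrary: u)
  case (Cons e p)
  then show ?case using assms[of e] by (cases "p = []") (auto intro: less_trans)
qed simp

lemma (in fin_digraph) fv_le_tau: "fv G \<le> tau (arcs_ends G) (verts G)"
proof -
  obtain S where S: "S \<subseteq> verts G" "acyc (arcs_ends G) (verts G - S)" "card S = tau (arcs_ends G) (verts G)"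
    by (rule tau_attained)
  obtain f :: "'a \<Rightarrow> nat" where
    f: "\<And>x y. x \<in> verts G - S \<Longrightarrow> y \<in> verts G - S \<Longrightarrow> (x, y) \<in> arcs_ends G \<Longrightarrow> f x < f y"
    using acycE[OF S(2)] by blast
  let ?H = "G \<restriction> (verts G - S)"
  have rank: "f (tail ?H e) < f (head ?H e)" if "e \<in> arcs ?H" for e
    using that by (auto intro!: f simp: arcs_ends_conv)
  have "\<not> pre_digraph.cycle ?H p" for p
  proof
    assume "pre_digraph.cycle ?H p"
    then obtain u where "pre_digraph.cas ?H u p u" "set p \<subseteq> arcs ?H" "p \<noteq> []"
      unfolding pre_digraph.cycle_def pre_digraph.awalk_def by blast
    from pre_digraph.rank_awalk[of ?H f, OF rank this] show False by simp
  qed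
  then have "feedback_vertex_set G S" using S(1) by (simp add: feedback_vertex_set_def)
  then show ?thesis unfolding fv_def S(3)[symmetric] by (intro Least_le) blast
qed

lemma (in fin_digraph) deg_arcs_ends_le: "deg (arcs_ends G) v \<le> vertex_degree G v"
proof -
  have "arcs_ends G `` {v} \<subseteq> head G ` out_arcs G v" "(arcs_ends G)\<inverse> `` {v} \<subseteq> tail G ` in_arcs G v"
    by (auto simp: arcs_ends_conv out_arcs_def in_arcs_def)
  then have "card (arcs_ends G `` {v}) \<le> out_degree G v" "card ((arcs_ends G)\<inverse> `` {v}) \<le> in_degree G v"
    unfolding out_degree_def in_degree_def
    by (meson card_image_le card_mono finite_imageI finite_in_arcs finite_out_arcs le_trans)+
  then show ?thesis by (simp add: deg_def vertex_degree_def)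
qed

theorem corollary11:
  fixes G :: "('a, 'b) pre_digraph" and n :: nat
  assumes "oriented_graph G"
    and "card (verts G) = n"
    and "\<forall>v\<in>verts G. vertex_degree G v \<le> 6"
  shows "real (fv G) \<le> 4 * real n / 7"
proof -
  interpret oriented_graph G by fact
  have "7 * tau (arcs_ends G) (verts G) \<le> 4 * card (verts G)"
  proof (rule tau_le_deg_6)
    show "arcs_ends G \<subseteq> verts G \<times> verts G" by (auto simp: arcs_ends_conv)
    show "deg (arcs_ends G) v \<le> 6" if "v \<in> verts G" for v
      using deg_arcs_ends_le[of v] assms(3) that by force
  qed (use no_digons in auto)
  then have "7 * fv G \<le> 4 * n" using fv_le_tau assms(2) by linarith
  then show ?thesis by simp
qed

end
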